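(* Consider the deterministic control problem described in the context, and assume all of its standing assumptions (1)--(6). Assume moreover that there exists $\sigma_h>0$ such that $D_h(v\mid u)\ge\frac{\sigma_h}{2}|v-u|^2$ for all $u,v\in U$. Then there exists a positive constant $L$ such that for all $u,v\in\mathcal{U}$, $$J^\tau(v)-J^\tau(u)\le dJ^\tau(u)(v-u)+L\,\mathcal{D}_h(v\mid u).$$ Equivalently, $$J^\tau(v)-J^\tau(u)\le-\int_0^T\nabla_u\mathcal{H}_t^\tau(x_t^u,p_t^u,u_t)\cdot(v_t-u_t)\,dt+L\int_0^T D_h(v_t\mid u_t)\,dt,$$ where $(x^u,p^u)$ is the state-adjoint pair associated with $u$.
   Context: Control problem. Fix $T>0$, $x_0\in\mathbb{R}^d$, $\tau\ge 0$, a set $U\subset\mathbb{R}^m$, and maps $b:[0,T]\times\mathbb{R}^d\times U\to\mathbb{R}^d$, $f:[0,T]\times\mathbb{R}^d\times U\to\mathbb{R}$, $g:\mathbb{R}^d\to\mathbb{R}$, $h:U\to\mathbb{R}$; write $b_t(x,u)=b(t,x,u)$ and $f_t(x,u)=f(t,x,u)$. The control space is $\mathcal{U}:=C([0,T];U)$. For $u\in\mathcal{U}$ the state $x=x^u$ is the solution of $\dot x_t=b_t(x_t,u_t)$ on $[0,T]$ with initial value $x_0$. The cost is $$J^\tau(u)=\int_0^T\bigl(f_t(x_t,u_t)+\tau h(u_t)\bigr)\,dt+g(x_T).$$ Hamiltonians: $\mathcal{H}_t^0(x,p,u)=p\cdot b_t(x,u)-f_t(x,u)$ and $\mathcal{H}_t^\tau(x,p,u)=\mathcal{H}_t^0(x,p,u)-\tau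 h(u)$, so $\nabla_u\mathcal{H}_t^\tau(x,p,u)=\nabla_u b_t(x,u)^\top p-\nabla_u f_t(x,u)-\tau\nabla h(u)$. The adjoint $p=p^u$ associated with $u$ (and its state $x$) is the solution of $\dot p_t=-\nabla_x\mathcal{H}_t^0(x_t,p_t,u_t)$, $p_T=-\nabla g(x_T)$. For every $u\in\mathcal{U}$ the state and adjoint exist and are unique under the standing assumptions. Norms: $|\cdot|$ is the Euclidean norm of vectors and the spectral norm of matrices; $\|\cdot\|$ is the operator norm. Standing assumptions: (1) $U$ is a nonempty, closed, convex subset of $\mathbb{R}^m$. (2) $b$ and $f$ are continuous, and there is $M>0$ such that for $\varphi=b,f$: $|\varphi_t(x,u)-\varphi_t(x',u')|\le M(|x-x'|+|u-u'|)$ and $|\varphi_t(0,u)|\le M$ for all $t\in[0,T]$, $x,x'\in\mathbb{R}^d$, $u,u'\in U$. (3) For $\varphi=b,f$, $\varphi_t(x,u)$ is twice continuously differentiable in $(x,u)$, and, with the same $M$ (possibly increased), $|\nabla_x\varphi_t(x,u)-\nabla_x\varphi_t(x',u')|\le M(|x-x'|+|u-u'|)$ for all $t,x,x',u,u'$. There are constants $M_{b,uu},M_{f,uu}>0$ with $\|\nabla^2_{uu}b_t(x,u)\|\le M_{b,uu}$ and $\|\nabla^2_{uu}f_t(x,u)\|\le M_{f,uu}$ for all $(t,x,u)$. (Consequently $\nabla_x b,\nabla_u b,\nabla_x f,\nabla_u f$ and $\nabla^2_{xx}b,\nabla^2_{xu}b,\nabla^2_{xx}f,\nabla^2_{xu}f$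 are uniformly bounded by $M$.) (4) $g$ is continuously differentiable with $\max\{|g(x)-g(x')|,|\nabla g(x)-\nabla g(x')|\}\le M|x-x'|$ for all $x,x'$, and $|g(0)|\le M$. (5) $h$ is convex and continuously differentiable. (6) There exists $u^*\in\mathcal{U}$ minimizing $J^\tau$ over $\mathcal{U}$. Bregman divergences: $D_h(v\mid u)=h(v)-h(u)-\nabla h(u)\cdot(v-u)$ for $u,v\in U$, and $\mathcal{D}_h(v\mid u)=\int_0^T D_h(v_t\mid u_t)\,dt$ for $u,v\in\mathcal{U}$. Directional derivative: for $u,v\in\mathcal{U}$, $dJ^\tau(u)(v-u):=\lim_{\varepsilon\to0^+}\varepsilon^{-1}\bigl(J^\tau(u+\varepsilon(v-u))-J^\tau(u)\bigr)$; under the standing assumptions it exists and equals $-\int_0^T\nabla_u\mathcal{H}_t^\tau(x_t,p_t,u_t)\cdot(v_t-u_t)\,dt$, where $(x,p)$ is the state-adjoint pair of $u$. *)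

theory Defs
  imports "HOL-Analysis.Analysis"
begin

text \<open>
  The control set \<open>U\<close> is only assumed closed and convex, so derivatives in the control variable
  are derivatives within \<open>U\<close> (one-sided at boundary points). All coefficients are total
  functions of which only the values for \<open>t \<in> {0..T}\<close> and \<open>u \<in> U\<close> matter.
\<close>

definition C1_on :: "'a::real_normed_vector set \<Rightarrow> ('a \<Rightarrow> 'b::real_normed_vector) \<Rightarrow> bool" where
  "C1_on S F \<longleftrightarrow>
     (\<exists>F' :: 'a \<Rightarrow> 'a \<Rightarrow>\<^sub>L 'b.
        (\<forall>z\<in>S. (F has_derivative blinfun_apply (F' z)) (at z within S)) \<and> continuous_on S F')"

definition C2_on_with ::
  "'a::real_normed_vector set \<Rightarrow> ('a \<Rightarrow> 'b::real_normed_vector) \<Rightarrow>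
     ('a \<Rightarrow> 'a \<Rightarrow>\<^sub>L 'b) \<Rightarrow> ('a \<Rightarrow> 'a \<Rightarrow>\<^sub>L ('a \<Rightarrow>\<^sub>L 'b)) \<Rightarrow> bool" where
  "C2_on_with S F F' F'' \<longleftrightarrow>
     (\<forall>z\<in>S. (F has_derivative blinfun_apply (F' z)) (at z within S) \<and>
            (F' has_derivative blinfun_apply (F'' z)) (at z within S)) \<and>
     continuous_on S F''"

text \<open>
  If \<open>S\<close> is convex with empty interior, the gradient within \<open>S\<close> is not unique, but its inner
  product with \<open>y - x\<close> is, for all \<open>y \<in> S\<close> (lemma \<open>inner_gradient_within\<close>); on controls,
  gradients are only ever paired with such directions.
\<close>

definition gradient_within :: "'a::real_inner set \<Rightarrow> ('a \<Rightarrow> real) \<Rightarrow> 'a \<Rightarrow> 'a" where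
  "gradient_within S F x = (SOME v. (F has_derivative (\<lambda>k. v \<bullet> k)) (at x within S))"

abbreviation gradient :: "('a::real_inner \<Rightarrow> real) \<Rightarrow> 'a \<Rightarrow> 'a" where
  "gradient \<equiv> gradient_within UNIV"

lemma inner_gradient_within:
  fixes F :: "'a::euclidean_space \<Rightarrow> real"
  assumes S: "convex S" "x \<in> S" "y \<in> S"
    and F: "(F has_derivative F') (at x within S)"
  shows "gradient_within S F x \<bullet> (y - x) = F' (y - x)"
proof -
  have lin: "linear F'"
    using F has_derivative_linear by blast
  have "F' = (\<lambda>k. adjoint F' 1 \<bullet> k)"
    using adjoint_works[OF lin] by (auto simp: inner_commute)
  then have "\<exists>v. (F has_derivative (\<lambda>k. v \<bullet> k)) (at x within S)"
    using F by metis
  then have G: "(F has_derivative (\<lambda>k. gradient_within S F x \<bullet> k)) (at x within S)"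
    unfolding gradient_within_def by (rule someI_ex)
  define c where "c s = x + s *\<^sub>R (y - x)" for s :: real
  have c: "(c has_derivative (\<lambda>s. s *\<^sub>R (y - x))) (at 0 within {0..1})"
    unfolding c_def by (auto intro!: derivative_eq_intros)
  have "c ` {0..1} \<subseteq> S"
    using S by (auto simp: c_def algebra_simps convex_alt)
  then have along: "((F \<circ> c) has_vector_derivative D (y - x)) (at 0 within {0..1})"
    if D: "(F has_derivative D) (at x within S)" for D
  proof -
    have "(F has_derivative D) (at (c 0) within c ` {0..1})"
      using D \<open>c ` {0..1} \<subseteq> S\<close> by (simp add: c_def[of 0] has_derivative_subset)
    from diff_chain_within[OF c this] show ?thesis
      by (simp add: has_vector_derivative_def o_def
          linear_scale[OF has_derivative_linear[OF D]])
  qed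
  show ?thesis
    using vector_derivative_unique_within_closed_interval[of 0 1 0] along[OF G] along[OF F]
    by (simp add: box_real)
qed

definition inclusion_fst :: "'a::real_normed_vector \<Rightarrow>\<^sub>L ('a \<times> 'b::real_normed_vector)" where
  "inclusion_fst = Blinfun (\<lambda>k. (k, 0))"

definition inclusion_snd :: "'b::real_normed_vector \<Rightarrow>\<^sub>L ('a::real_normed_vector \<times> 'b)" where
  "inclusion_snd = Blinfun (\<lambda>k. (0, k))"

lemma inclusion_apply [simp]:
  "blinfun_apply inclusion_fst k = (k, 0)"
  "blinfun_apply inclusion_snd l = (0, l)"
  by (simp_all add: inclusion_fst_def inclusion_snd_def bounded_linear_Blinfun_apply
      bounded_linear_Pair bounded_linear_ident bounded_linear_zero)

definition first_order_regular ::
  "real \<Rightarrow> (real ^ 'm) set \<Rightarrow> real \<Rightarrow>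
     (real \<Rightarrow> real ^ 'd \<Rightarrow> real ^ 'm \<Rightarrow> 'b::real_normed_vector) \<Rightarrow> bool" where
  "first_order_regular T U M \<phi> \<longleftrightarrow>
     continuous_on ({0..T} \<times> UNIV \<times> U) (\<lambda>(t, x, u). \<phi> t x u) \<and>
     (\<forall>t\<in>{0..T}. \<forall>x x'. \<forall>u\<in>U. \<forall>u'\<in>U.
        norm (\<phi> t x u - \<phi> t x' u') \<le> M * (norm (x - x') + norm (u - u'))) \<and>
     (\<forall>t\<in>{0..T}. \<forall>u\<in>U. norm (\<phi> t 0 u) \<le> M)"

text \<open>
  With \<open>D t\<close> and \<open>D2 t\<close> the first and second derivatives of \<open>\<phi> t\<close> in \<open>(x, u)\<close>,
  \<open>D t (x, u) o\<^sub>L inclusion_fst\<close> is the partial derivative in \<open>x\<close>, and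
  \<open>\<lambda>k. D2 t (x, u) (0, k) o\<^sub>L inclusion_snd\<close> is the second partial derivative in \<open>u\<close>.
\<close>

definition second_order_regular ::
  "real \<Rightarrow> (real ^ 'm) set \<Rightarrow> real \<Rightarrow> real \<Rightarrow>
     (real \<Rightarrow> real ^ 'd \<Rightarrow> real ^ 'm \<Rightarrow> 'b::real_normed_vector) \<Rightarrow> bool" where
  "second_order_regular T U M Muu \<phi> \<longleftrightarrow>
     (\<exists>D D2.
        (\<forall>t\<in>{0..T}. C2_on_with (UNIV \<times> U) (\<lambda>(x, u). \<phi> t x u) (D t) (D2 t)) \<and>
        (\<forall>t\<in>{0..T}. \<forall>x x'. \<forall>u\<in>U. \<forall>u'\<in>U.
           norm ((D t (x, u) o\<^sub>L inclusion_fst) - (D t (x', u') o\<^sub>L inclusion_fst))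
             \<le> M * (norm (x - x') + norm (u - u'))) \<and>
        (\<forall>t\<in>{0..T}. \<forall>x. \<forall>u\<in>U.
           onorm (\<lambda>k. blinfun_apply (D2 t (x, u)) (0, k) o\<^sub>L inclusion_snd) \<le> Muu))"

definition controls :: "real \<Rightarrow> (real ^ 'm) set \<Rightarrow> (real \<Rightarrow> real ^ 'm) set" where
  "controls T U = {u. continuous_on {0..T} u \<and> u ` {0..T} \<subseteq> U}"

definition is_state ::
  "real \<Rightarrow> real ^ 'd \<Rightarrow> (real \<Rightarrow> real ^ 'd \<Rightarrow> real ^ 'm \<Rightarrow> real ^ 'd) \<Rightarrow>
     (real \<Rightarrow> real ^ 'm) \<Rightarrow> (real \<Rightarrow> real ^ 'd) \<Rightarrow> bool" where
  "is_state T x0 b u x \<longleftrightarrow>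
     x 0 = x0 \<and>
     (\<forall>t\<in>{0..T}. (x has_vector_derivative b t (x t) (u t)) (at t within {0..T}))"

text \<open>
  Solutions are unique on \<open>{0..T}\<close> but arbitrary outside, hence \<open>SOME\<close> rather than \<open>THE\<close>
  here and for the adjoint; only their values on \<open>{0..T}\<close> are used.
\<close>

definition state ::
  "real \<Rightarrow> real ^ 'd \<Rightarrow> (real \<Rightarrow> real ^ 'd \<Rightarrow> real ^ 'm \<Rightarrow> real ^ 'd) \<Rightarrow>
     (real \<Rightarrow> real ^ 'm) \<Rightarrow> real \<Rightarrow> real ^ 'd" where
  "state T x0 b u = (SOME x. is_state T x0 b u x)"

definition cost ::
  "real \<Rightarrow> real ^ 'd \<Rightarrow> real \<Rightarrow> (real \<Rightarrow> real ^ 'd \<Rightarrow> real ^ 'm \<Rightarrow> real ^ 'd) \<Rightarrow>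
     (real \<Rightarrow> real ^ 'd \<Rightarrow> real ^ 'm \<Rightarrow> real) \<Rightarrow> (real ^ 'd \<Rightarrow> real) \<Rightarrow> (real ^ 'm \<Rightarrow> real) \<Rightarrow>
     (real \<Rightarrow> real ^ 'm) \<Rightarrow> real" where
  "cost T x0 \<tau> b f g h u =
     integral {0..T} (\<lambda>t. f t (state T x0 b u t) (u t) + \<tau> * h (u t)) + g (state T x0 b u T)"

definition hamiltonian0 ::
  "(real \<Rightarrow> real ^ 'd \<Rightarrow> real ^ 'm \<Rightarrow> real ^ 'd) \<Rightarrow> (real \<Rightarrow> real ^ 'd \<Rightarrow> real ^ 'm \<Rightarrow> real) \<Rightarrow>
     real \<Rightarrow> real ^ 'd \<Rightarrow> real ^ 'd \<Rightarrow> real ^ 'm \<Rightarrow> real" where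
  "hamiltonian0 b f t x p u = p \<bullet> b t x u - f t x u"

definition hamiltonian ::
  "real \<Rightarrow> (real \<Rightarrow> real ^ 'd \<Rightarrow> real ^ 'm \<Rightarrow> real ^ 'd) \<Rightarrow>
     (real \<Rightarrow> real ^ 'd \<Rightarrow> real ^ 'm \<Rightarrow> real) \<Rightarrow> (real ^ 'm \<Rightarrow> real) \<Rightarrow>
     real \<Rightarrow> real ^ 'd \<Rightarrow> real ^ 'd \<Rightarrow> real ^ 'm \<Rightarrow> real" where
  "hamiltonian \<tau> b f h t x p u = hamiltonian0 b f t x p u - \<tau> * h u"

definition is_adjoint_state ::
  "real \<Rightarrow> (real \<Rightarrow> real ^ 'd \<Rightarrow> real ^ 'm \<Rightarrow> real ^ 'd) \<Rightarrow>
     (real \<Rightarrow> real ^ 'd \<Rightarrow> real ^ 'm \<Rightarrow> real) \<Rightarrow> (real ^ 'd \<Rightarrow> real) \<Rightarrow>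
     (real \<Rightarrow> real ^ 'm) \<Rightarrow> (real \<Rightarrow> real ^ 'd) \<Rightarrow> (real \<Rightarrow> real ^ 'd) \<Rightarrow> bool" where
  "is_adjoint_state T b f g u x p \<longleftrightarrow>
     p T = - gradient g (x T) \<and>
     (\<forall>t\<in>{0..T}.
        (p has_vector_derivative - gradient (\<lambda>y. hamiltonian0 b f t y (p t) (u t)) (x t))
          (at t within {0..T}))"

definition adjoint_state ::
  "real \<Rightarrow> real ^ 'd \<Rightarrow> (real \<Rightarrow> real ^ 'd \<Rightarrow> real ^ 'm \<Rightarrow> real ^ 'd) \<Rightarrow>
     (real \<Rightarrow> real ^ 'd \<Rightarrow> real ^ 'm \<Rightarrow> real) \<Rightarrow> (real ^ 'd \<Rightarrow> real) \<Rightarrow>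
     (real \<Rightarrow> real ^ 'm) \<Rightarrow> real \<Rightarrow> real ^ 'd" where
  "adjoint_state T x0 b f g u = (SOME p. is_adjoint_state T b f g u (state T x0 b u) p)"

definition bregman :: "(real ^ 'm) set \<Rightarrow> (real ^ 'm \<Rightarrow> real) \<Rightarrow> real ^ 'm \<Rightarrow> real ^ 'm \<Rightarrow> real" where
  "bregman U h v u = h v - h u - gradient_within U h u \<bullet> (v - u)"

definition bregman_path ::
  "real \<Rightarrow> (real ^ 'm) set \<Rightarrow> (real ^ 'm \<Rightarrow> real) \<Rightarrow>
     (real \<Rightarrow> real ^ 'm) \<Rightarrow> (real \<Rightarrow> real ^ 'm) \<Rightarrow> real" where
  "bregman_path T U h v u = integral {0..T} (\<lambda>t. bregman U h (v t) (u t))"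

text \<open>The one-sided directional derivative of \<open>J\<close> at \<open>u\<close> in the direction \<open>v - u\<close>.\<close>

definition dir_deriv ::
  "((real \<Rightarrow> real ^ 'm) \<Rightarrow> real) \<Rightarrow> (real \<Rightarrow> real ^ 'm) \<Rightarrow> (real \<Rightarrow> real ^ 'm) \<Rightarrow> real" where
  "dir_deriv J u v =
     Lim (at_right 0) (\<lambda>\<epsilon>. (J (\<lambda>t. u t + \<epsilon> *\<^sub>R (v t - u t)) - J u) / \<epsilon>)"

end

theory Submission
  imports Defs
begin

text \<open>
  Let \<open>p\<close> be the adjoint of \<open>u\<close>. Integrating \<open>p \<bullet> (x\<^sup>v - x\<^sup>u)\<close> by parts shows that
  \<open>J(v) - J(u) + \<integral> \<nabla>\<^sub>u H(x\<^sup>u, p, u) \<bullet> (v - u)\<close>, for the cost \<open>J\<close> without the \<open>h\<close> term, consists of the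
  second-order Taylor remainders of \<open>b\<close>, \<open>f\<close> and \<open>g\<close>. By Gronwall, \<open>p\<close> is bounded uniformly in \<open>u\<close>
  and \<open>\<bar>x\<^sup>v - x\<^sup>u\<bar>\<^sup>2 \<le> K \<integral> \<bar>v - u\<bar>\<^sup>2\<close>, so the absolute value of this expression is at most \<open>C \<integral> \<bar>v - u\<bar>\<^sup>2\<close>.
  Applied to \<open>u + \<epsilon> (v - u)\<close>, this two-sided estimate gives the directional derivative; applied to \<open>v\<close>,
  together with \<open>\<sigma> / 2 * \<bar>v - u\<bar>\<^sup>2 \<le> D\<^sub>h(v | u)\<close> and the exact identity for the \<open>h\<close> term, it gives the
  bound with \<open>L = \<tau> + 2 * C / \<sigma>\<close>.
\<close>

subsection \<open>Lipschitz differential equations\<close>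

text \<open>Clamping time to \<open>{0..T}\<close> extends a path by constants to a bounded
  continuous function on the whole line. This makes the complete type of bounded continuous
  functions, with its sup distance, available for Banach's fixed point theorem.\<close>

lemma bcontfun_clamp:
  fixes F :: "real \<Rightarrow> 'a::euclidean_space"
  assumes "0 \<le> T" and F: "continuous_on {0..T} F"
  shows "(\<lambda>t. F (max 0 (min T t))) \<in> bcontfun"
proof -
  have sub: "(\<lambda>t. max 0 (min T t)) ` UNIV \<subseteq> {0..T}"
    using \<open>0 \<le> T\<close> by auto
  have "continuous_on UNIV (\<lambda>t. F (max 0 (min T t)))"
    by (rule continuous_on_compose2[OF F _ sub]) (intro continuous_intros)
  moreover have "bounded (F ` {0..T})"
    by (intro compact_imp_bounded compact_continuous_image F) simp
  then have "bounded (range (\<lambda>t. F (max 0 (min T t))))"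
    by (rule bounded_subset) (use sub in auto)
  ultimately show ?thesis
    by (simp add: bcontfun_def)
qed

lemma has_integral_exp_Icc:
  fixes K :: real
  assumes "K > 0" "0 \<le> t"
  shows "((\<lambda>s. K * exp (2 * K * s)) has_integral (exp (2 * K * t) - 1) / 2) {0..t}"
proof -
  have "((\<lambda>s. exp (2 * K * s) / 2) has_vector_derivative K * exp (2 * K * s)) (at s within {0..t})" for s
    by (auto intro!: derivative_eq_intros
        simp: has_real_derivative_iff_has_vector_derivative[symmetric])
  from fundamental_theorem_of_calculus[OF \<open>0 \<le> t\<close> this] show ?thesis
    by (simp add: diff_divide_distrib)
qed

text \<open>
  Picard iteration for \<open>x t = exp (2 * K * t) *\<^sub>R y t\<close> is a contraction with constant 1/2 on all of
  \<open>{0..T}\<close>, so no gluing of local solutions is needed.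
\<close>

lemma ode_solution_exists:
  fixes F :: "real \<Rightarrow> 'a::euclidean_space \<Rightarrow> 'a"
  assumes T: "0 \<le> T"
    and K: "\<And>t x y. t \<in> {0..T} \<Longrightarrow> norm (F t x - F t y) \<le> K * norm (x - y)"
    and cont: "\<And>x. continuous_on {0..T} x \<Longrightarrow> continuous_on {0..T} (\<lambda>t. F t (x t))"
  obtains x where "x 0 = x0"
    and "\<And>t. t \<in> {0..T} \<Longrightarrow> (x has_vector_derivative F t (x t)) (at t within {0..T})"
proof -
  \<comment> \<open>\<open>K\<close> may be zero, while \<open>has_integral_exp_Icc\<close> asks for
    a positive rate.\<close>
  define C where "C = max 1 K"
  have C: "C > 0" "\<And>t x y. t \<in> {0..T} \<Longrightarrow> norm (F t x - F t y) \<le> C * norm (x - y)"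
  proof -
    show "norm (F t x - F t y) \<le> C * norm (x - y)" if "t \<in> {0..T}" for t x y
      by (rule order_trans[OF K[OF that]]) (auto simp: C_def intro: mult_right_mono)
  qed (simp add: C_def)
  define \<Phi> where "\<Phi> y t = exp (- (2 * C * t)) *\<^sub>R
      (x0 + integral {0..t} (\<lambda>s. F s (exp (2 * C * s) *\<^sub>R apply_bcontfun y s)))"
    for y :: "real \<Rightarrow>\<^sub>C 'a" and t
  have contF: "continuous_on {0..T} (\<lambda>s. F s (exp (2 * C * s) *\<^sub>R apply_bcontfun y s))" for y
    by (intro cont continuous_intros) auto
  have int: "(\<lambda>s. F s (exp (2 * C * s) *\<^sub>R apply_bcontfun y s)) integrable_on {0..t}"
    if "t \<in> {0..T}" for t y
    using that by (intro integrable_continuous_real continuous_on_subset[OF contF]) auto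
  have cont\<Phi>: "continuous_on {0..T} (\<Phi> y)" for y
    unfolding \<Phi>_def
    by (intro continuous_intros indefinite_integral_continuous_1 integrable_continuous_real contF)
  define \<Psi> where "\<Psi> y = Bcontfun (\<lambda>t. \<Phi> y (max 0 (min T t)))" for y
  have \<Psi>: "apply_bcontfun (\<Psi> y) t = \<Phi> y (max 0 (min T t))" for y t
    unfolding \<Psi>_def using Bcontfun_inverse[OF bcontfun_clamp[OF T cont\<Phi>[of y]]] by simp
  have contr: "dist (\<Phi> y t) (\<Phi> z t) \<le> 1 / 2 * dist y z" if t: "t \<in> {0..T}" for y z t
  proof -
    have pt: "norm (F s (exp (2 * C * s) *\<^sub>R apply_bcontfun y s) - F s (exp (2 * C * s) *\<^sub>R apply_bcontfun z s))
        \<le> C * exp (2 * C * s) * dist y z" if "s \<in> {0..t}" for s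
    proof -
      have "norm (F s (exp (2 * C * s) *\<^sub>R apply_bcontfun y s) - F s (exp (2 * C * s) *\<^sub>R apply_bcontfun z s))
          \<le> C * norm (exp (2 * C * s) *\<^sub>R apply_bcontfun y s - exp (2 * C * s) *\<^sub>R apply_bcontfun z s)"
        using that t by (intro C) auto
      also have "\<dots> = C * (exp (2 * C * s) * dist (apply_bcontfun y s) (apply_bcontfun z s))"
        by (simp add: scaleR_diff_right[symmetric] dist_norm)
      also have "\<dots> \<le> C * (exp (2 * C * s) * dist y z)"
        using C by (intro mult_left_mono dist_bounded) auto
      finally show ?thesis by (simp add: mult.assoc)
    qed
    have hi: "((\<lambda>s. C * exp (2 * C * s) * dist y z) has_integral (exp (2 * C * t) - 1) / 2 * dist y z) {0..t}"
      using has_integral_exp_Icc[of C t] C t by (intro has_integral_mult_left) auto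
    have "norm (integral {0..t} (\<lambda>s. F s (exp (2 * C * s) *\<^sub>R apply_bcontfun y s) - F s (exp (2 * C * s) *\<^sub>R apply_bcontfun z s)))
        \<le> (exp (2 * C * t) - 1) / 2 * dist y z"
      unfolding integral_unique[OF hi, symmetric]
      by (intro integral_norm_bound_integral integrable_diff int[OF t] has_integral_integrable[OF hi] pt)
    \<comment> \<open>Without the \<open>- 1\<close>, the weight \<open>exp (- (2 * C * t))\<close>
      in \<open>\<Phi>\<close> cancels the exponential exactly and leaves the contraction constant
      1/2.\<close>
    also have "\<dots> \<le> exp (2 * C * t) / 2 * dist y z"
      by (intro mult_right_mono) auto
    finally have "norm (integral {0..t} (\<lambda>s. F s (exp (2 * C * s) *\<^sub>R apply_bcontfun y s))
        - integral {0..t} (\<lambda>s. F s (exp (2 * C * s) *\<^sub>R apply_bcontfun z s))) \<le> exp (2 * C * t) / 2 * dist y z"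
      using int[OF t] by (simp add: integral_diff)
    then show ?thesis
      unfolding \<Phi>_def dist_norm[of "_ *\<^sub>R _"] scaleR_diff_right[symmetric]
      by (simp add: exp_minus pos_divide_le_eq mult.commute divide_inverse_commute[symmetric])
  qed
  have "dist (\<Psi> y) (\<Psi> z) \<le> 1 / 2 * dist y z" for y z
  proof (rule dist_bound)
    show "dist (apply_bcontfun (\<Psi> y) t) (apply_bcontfun (\<Psi> z) t) \<le> 1 / 2 * dist y z" for t
      unfolding \<Psi> by (rule contr) (use T in auto)
  qed
  then obtain y where y: "\<Psi> y = y"
    using banach_fix_type[of "1 / 2" \<Psi>] by auto
  \<comment> \<open>On \<open>{0..T}\<close> this is the fixed point in the original unknown,
    \<open>exp (2 * C * t) *\<^sub>R y t\<close>; written as an indefinite integral it is visibly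
    differentiable.\<close>
  define x where "x t = x0 + integral {0..t} (\<lambda>s. F s (exp (2 * C * s) *\<^sub>R apply_bcontfun y s))" for t
  have x: "exp (2 * C * t) *\<^sub>R apply_bcontfun y t = x t" if "t \<in> {0..T}" for t
    using \<Psi>[of y t] that unfolding y by (simp add: \<Phi>_def x_def exp_minus)
  show ?thesis
  proof
    show "x 0 = x0" by (simp add: x_def)
    show "(x has_vector_derivative F t (x t)) (at t within {0..T})" if "t \<in> {0..T}" for t
    proof -
      have "(x has_vector_derivative F t (exp (2 * C * t) *\<^sub>R apply_bcontfun y t)) (at t within {0..T})"
        using integral_has_vector_derivative[OF contF[of y] that]
        unfolding x_def[abs_def] by (auto intro!: derivative_eq_intros)
      then show ?thesis
        by (simp only: x[OF that])
    qed
  qed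
qed

text \<open>Working with the square avoids differentiating the norm at zero and produces the L2 norm
  of the forcing term \<open>a\<close>. By Cauchy-Schwarz and Young,
  \<open>2 * (z \<bullet> z')\<close> is at most
  \<open>3 * M * (norm z)\<^sup>2 + M * a\<^sup>2\<close>, so the weight
  \<open>exp (- (3 * M * s))\<close> absorbs the first term and the rest is integrated.\<close>

lemma gronwall_square:
  fixes z :: "real \<Rightarrow> 'a::real_inner"
  assumes M: "M > 0"
    and z: "\<And>t. t \<in> {0..T} \<Longrightarrow> (z has_vector_derivative z' t) (at t within {0..T})"
    and z': "\<And>t. t \<in> {0..T} \<Longrightarrow> norm (z' t) \<le> M * (norm (z t) + a t)"
    and a: "continuous_on {0..T} a"
    and t: "t \<in> {0..T}"
  shows "(norm (z t))\<^sup>2 \<le> exp (3 * M * T) * ((norm (z 0))\<^sup>2 + M * integral {0..T} (\<lambda>s. (a s)\<^sup>2))"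
proof -
  define \<phi> where "\<phi> s = exp (- (3 * M * s)) * (z s \<bullet> z s)" for s
  define \<phi>' where "\<phi>' s = exp (- (3 * M * s)) * (2 * (z s \<bullet> z' s)) - 3 * M * exp (- (3 * M * s)) * (z s \<bullet> z s)" for s
  have inner': "((\<lambda>s. z s \<bullet> z s) has_real_derivative 2 * (z s \<bullet> z' s)) (at s within {0..t})" if "s \<in> {0..t}" for s
  proof -
    have "(z has_vector_derivative z' s) (at s within {0..t})"
      using that t by (intro has_vector_derivative_within_subset[OF z]) auto
    note z = this[unfolded has_vector_derivative_def]
    show ?thesis
      unfolding has_field_derivative_def
      by (rule has_derivative_eq_rhs[OF has_derivative_inner[OF z z]])
        (auto simp: inner_commute algebra_simps)
  qed
  have \<phi>: "(\<phi> has_vector_derivative \<phi>' s) (at s within {0..t})" if "s \<in> {0..t}" for s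
    unfolding \<phi>_def \<phi>'_def has_real_derivative_iff_has_vector_derivative[symmetric]
    by (auto intro!: derivative_eq_intros inner'[OF that])
  have le: "\<phi>' s \<le> M * (a s)\<^sup>2" if "s \<in> {0..t}" for s
  proof -
    have "z s \<bullet> z' s \<le> norm (z s) * norm (z' s)"
      by (rule norm_cauchy_schwarz)
    also have "\<dots> \<le> norm (z s) * (M * (norm (z s) + a s))"
      using that t by (intro mult_left_mono z') auto
    finally have "2 * (z s \<bullet> z' s) \<le> 2 * M * (norm (z s))\<^sup>2 + M * (2 * norm (z s) * a s)"
      by (simp add: power2_eq_square algebra_simps)
    also have "\<dots> \<le> 2 * M * (norm (z s))\<^sup>2 + M * ((norm (z s))\<^sup>2 + (a s)\<^sup>2)"
      using M by (intro add_left_mono mult_left_mono sum_squares_bound) auto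
    finally have "2 * (z s \<bullet> z' s) - 3 * M * (z s \<bullet> z s) \<le> M * (a s)\<^sup>2"
      by (simp add: power2_norm_eq_inner algebra_simps)
    then have "exp (- (3 * M * s)) * (2 * (z s \<bullet> z' s) - 3 * M * (z s \<bullet> z s)) \<le> exp (- (3 * M * s)) * (M * (a s)\<^sup>2)"
      by (intro mult_left_mono) auto
    also have "\<dots> \<le> 1 * (M * (a s)\<^sup>2)"
      using M that by (intro mult_right_mono) auto
    finally show ?thesis
      by (simp add: \<phi>'_def algebra_simps)
  qed
  have int: "(\<lambda>s. M * (a s)\<^sup>2) integrable_on {0..T}"
    by (intro integrable_continuous_real continuous_intros a)
  have "\<phi> t - \<phi> 0 \<le> integral {0..t} (\<lambda>s. M * (a s)\<^sup>2)"
    using t by (intro has_integral_le[OF fundamental_theorem_of_calculus[OF _ \<phi>] integrable_integral le]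
        integrable_on_subinterval[OF int]) auto
  also have "\<dots> \<le> integral {0..T} (\<lambda>s. M * (a s)\<^sup>2)"
    using t M by (intro integral_subset_le integrable_on_subinterval[OF int] int) auto
  finally have "exp (3 * M * t) * \<phi> t \<le> exp (3 * M * t) * ((norm (z 0))\<^sup>2 + M * integral {0..T} (\<lambda>s. (a s)\<^sup>2))"
    by (simp add: \<phi>_def power2_norm_eq_inner)
  also have "\<dots> \<le> exp (3 * M * T) * ((norm (z 0))\<^sup>2 + M * integral {0..T} (\<lambda>s. (a s)\<^sup>2))"
    using M t by (intro mult_right_mono add_nonneg_nonneg mult_nonneg_nonneg integral_nonneg
        integrable_continuous_real continuous_intros a) auto
  also have "exp (3 * M * t) * \<phi> t = (norm (z t))\<^sup>2"
    by (simp add: \<phi>_def power2_norm_eq_inner mult.assoc[symmetric] mult_exp_exp)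
  finally show ?thesis .
qed

subsection \<open>Remainder estimates\<close>

text \<open>The segment stays in the convex set, so derivatives within \<open>S\<close> suffice for
  the chain rule, also when \<open>S\<close> has empty interior or the segment meets its
  boundary.\<close>

lemma has_derivative_along_segment:
  fixes F :: "'a::real_normed_vector \<Rightarrow> 'b::real_normed_vector"
  assumes "convex S" "x \<in> S" "y \<in> S"
    and F: "\<And>z. z \<in> S \<Longrightarrow> (F has_derivative F' z) (at z within S)"
    and s: "s \<in> {0..1}"
  shows "((\<lambda>s. F (x + s *\<^sub>R (y - x))) has_vector_derivative F' (x + s *\<^sub>R (y - x)) (y - x))
           (at s within {0..1})"
proof -
  define c where "c s = x + s *\<^sub>R (y - x)" for s :: real
  have c: "(c has_derivative (\<lambda>r. r *\<^sub>R (y - x))) (at s within {0..1})"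
    unfolding c_def by (auto intro!: derivative_eq_intros)
  have sub: "c ` {0..1} \<subseteq> S"
    using assms by (auto simp: c_def algebra_simps convex_alt)
  then have "(F has_derivative F' (c s)) (at (c s) within c ` {0..1})"
    using s by (intro has_derivative_subset[OF F]) auto
  moreover have "linear (F' (c s))"
    using F[of "c s"] sub s has_derivative_linear by blast
  ultimately show ?thesis
    using diff_chain_within[OF c, of F "F' (c s)"]
    by (simp add: has_vector_derivative_def o_def c_def linear_scale)
qed

text \<open>Mean value inequality for \<open>F\<close> along the segment from \<open>x\<close> to
  \<open>y\<close>: there the derivative in direction \<open>y - x\<close> deviates from its initial
  value by at most \<open>B * (norm (y - x))\<^sup>2\<close>.\<close>

lemma first_order_remainder_le:
  fixes F :: "'a::real_normed_vector \<Rightarrow> 'b::real_normed_vector"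
  assumes S: "convex S" "x \<in> S" "y \<in> S"
    and F: "\<And>z. z \<in> S \<Longrightarrow> (F has_derivative F' z) (at z within S)"
    and B: "\<And>z. z \<in> S \<Longrightarrow> norm (F' z (y - x) - F' x (y - x)) \<le> B * norm (z - x) * norm (y - x)"
    and "0 \<le> B"
  shows "norm (F y - F x - F' x (y - x)) \<le> B * (norm (y - x))\<^sup>2"
proof -
  have bnd: "norm (F' (x + s *\<^sub>R (y - x)) (y - x) - F' (x + 0 *\<^sub>R (y - x)) (y - x)) \<le> B * (norm (y - x))\<^sup>2"
    if "s \<in> {0..1}" for s
  proof -
    have "x + s *\<^sub>R (y - x) \<in> S"
      using S that by (auto simp: algebra_simps convex_alt)
    from B[OF this] have "norm (F' (x + s *\<^sub>R (y - x)) (y - x) - F' x (y - x)) \<le> s * (B * (norm (y - x))\<^sup>2)"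
      using that by (simp add: power2_eq_square mult_ac)
    also have "\<dots> \<le> 1 * (B * (norm (y - x))\<^sup>2)"
      using that \<open>0 \<le> B\<close> by (intro mult_right_mono) auto
    finally show ?thesis by simp
  qed
  have "norm (F (x + 1 *\<^sub>R (y - x)) - F (x + 0 *\<^sub>R (y - x))
      - (1 - 0) *\<^sub>R F' (x + 0 *\<^sub>R (y - x)) (y - x)) \<le> norm (1 - 0 :: real) * (B * (norm (y - x))\<^sup>2)"
    by (rule vector_differentiable_bound_linearization
        [OF has_derivative_along_segment[OF S F] _ bnd])
      (auto simp: closed_segment_eq_real_ivl)
  then show ?thesis by simp
qed

lemma lipschitz_derivative_le:
  fixes F :: "'a::real_normed_vector \<Rightarrow> 'b::real_normed_vector"
  assumes F: "(F has_derivative F') (at x)"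
    and L: "\<And>y. norm (F y - F x) \<le> M * norm (y - x)"
  shows "norm (F' k) \<le> M * norm k"
proof (cases "k = 0")
  case True
  then show ?thesis
    using linear_0[OF has_derivative_linear[OF F]] by simp
next
  case False
  have le: "norm (F' k) \<le> M * norm k + e * norm k" if "e > 0" for e
  proof -
    obtain d where "d > 0" and d: "\<And>y. norm (y - x) < d \<Longrightarrow> norm (F y - F x - F' (y - x)) \<le> e * norm (y - x)"
      using F \<open>e > 0\<close> unfolding has_derivative_at_alt by blast
    \<comment> \<open>With this choice \<open>s *\<^sub>R k\<close> has norm \<open>d / 2\<close>,
      so the differentiability estimate applies at \<open>x + s *\<^sub>R k\<close>; dividing by
      \<open>s\<close> afterwards gives the claim up to \<open>e * norm k\<close>.\<close>
    define s where "s = d / (2 * norm k)"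
    have s: "s > 0" "norm (s *\<^sub>R k) < d"
      using \<open>d > 0\<close> False by (auto simp: s_def)
    have "norm (F (x + s *\<^sub>R k) - F x - s *\<^sub>R F' k) \<le> e * (s * norm k)"
      using d[of "x + s *\<^sub>R k"] s by (simp add: linear_scale[OF has_derivative_linear[OF F]])
    moreover have "norm (F (x + s *\<^sub>R k) - F x) \<le> M * (s * norm k)"
      using L[of "x + s *\<^sub>R k"] s by simp
    moreover have "norm (s *\<^sub>R F' k) \<le> norm (F (x + s *\<^sub>R k) - F x) + norm (F (x + s *\<^sub>R k) - F x - s *\<^sub>R F' k)"
      using norm_triangle_ineq4[of "F (x + s *\<^sub>R k) - F x" "F (x + s *\<^sub>R k) - F x - s *\<^sub>R F' k"] by simp
    moreover have "norm (s *\<^sub>R F' k) = s * norm (F' k)"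
      using s by simp
    ultimately have "s * norm (F' k) \<le> s * (M * norm k + e * norm k)"
      unfolding distrib_left mult.left_commute[of s] by linarith
    then show ?thesis using s by simp
  qed
  show ?thesis
  proof (rule field_le_epsilon)
    show "norm (F' k) \<le> M * norm k + e" if "e > 0" for e
      using le[of "e / norm k"] that False by simp
  qed
qed

text \<open>The form in which \<open>b\<close> and \<open>f\<close> enter all estimates.
  \<open>D\<close> is the joint derivative in state and control. The bound on the second control
  derivative is replaced by its consequence \<open>remainder_control\<close>, and the mixed and
  second state derivatives by the Lipschitz bound on the state derivative.\<close>

locale smooth_coefficient =
  fixes T M K :: real
    and U :: "'u::real_normed_vector set"
    and \<phi> :: "real \<Rightarrow> 'x::real_normed_vector \<Rightarrow> 'u \<Rightarrow> 'b::real_normed_vector"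
    and D :: "real \<Rightarrow> 'x \<times> 'u \<Rightarrow> 'x \<times> 'u \<Rightarrow> 'b"
  assumes convex: "convex U"
    and M: "0 < M" and K: "0 \<le> K"
    and continuous: "continuous_on ({0..T} \<times> UNIV \<times> U) (\<lambda>(t, x, u). \<phi> t x u)"
    and lipschitz: "\<And>t x x' u u'. \<lbrakk>t \<in> {0..T}; u \<in> U; u' \<in> U\<rbrakk> \<Longrightarrow>
      norm (\<phi> t x u - \<phi> t x' u') \<le> M * (norm (x - x') + norm (u - u'))"
    and derivative: "\<And>t x u. \<lbrakk>t \<in> {0..T}; u \<in> U\<rbrakk> \<Longrightarrow>
      ((\<lambda>(x, u). \<phi> t x u) has_derivative D t (x, u)) (at (x, u) within UNIV \<times> U)"
    and derivative_lipschitz: "\<And>t x x' u u' k. \<lbrakk>t \<in> {0..T}; u \<in> U; u' \<in> U\<rbrakk> \<Longrightarrow>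
      norm (D t (x, u) (k, 0) - D t (x', u') (k, 0)) \<le> M * (norm (x - x') + norm (u - u')) * norm k"
    and remainder_control: "\<And>t x u v. \<lbrakk>t \<in> {0..T}; u \<in> U; v \<in> U\<rbrakk> \<Longrightarrow>
      norm (\<phi> t x v - \<phi> t x u - D t (x, u) (0, v - u)) \<le> K * (norm (v - u))\<^sup>2"
begin

lemma linear_D: "\<lbrakk>t \<in> {0..T}; u \<in> U\<rbrakk> \<Longrightarrow> linear (D t (x, u))"
  using derivative has_derivative_linear by blast

lemma D_split:
  assumes "t \<in> {0..T}" "u \<in> U"
  shows "D t (x, u) (k, l) = D t (x, u) (k, 0) + D t (x, u) (0, l)"
  using linear_add[OF linear_D[OF assms], of x "(k, 0)" "(0, l)"] by simp

lemma derivative_state: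
  assumes "t \<in> {0..T}" "u \<in> U"
  shows "((\<lambda>x. \<phi> t x u) has_derivative (\<lambda>k. D t (x, u) (k, 0))) (at x)"
proof -
  have "((\<lambda>x. (x, u)) has_derivative (\<lambda>k. (k, 0))) (at x)"
    by (auto intro!: derivative_eq_intros)
  moreover have "((\<lambda>(x, u). \<phi> t x u) has_derivative D t (x, u)) (at (x, u) within range (\<lambda>x. (x, u)))"
    by (rule has_derivative_subset[OF derivative[OF assms]]) (use assms in auto)
  ultimately show ?thesis
    using diff_chain_within[of "\<lambda>x. (x, u)" _ x UNIV "\<lambda>(x, u). \<phi> t x u"] by (simp add: o_def)
qed

lemma derivative_control:
  assumes "t \<in> {0..T}" "u \<in> U"
  shows "((\<lambda>u. \<phi> t x u) has_derivative (\<lambda>l. D t (x, u) (0, l))) (at u within U)"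
proof -
  have "((\<lambda>u. (x, u)) has_derivative (\<lambda>l. (0, l))) (at u within U)"
    by (auto intro!: derivative_eq_intros)
  moreover have "((\<lambda>(x, u). \<phi> t x u) has_derivative D t (x, u)) (at (x, u) within (\<lambda>u. (x, u)) ` U)"
    by (rule has_derivative_subset[OF derivative[OF assms]]) (use assms in auto)
  ultimately show ?thesis
    using diff_chain_within[of "\<lambda>u. (x, u)" _ u U "\<lambda>(x, u). \<phi> t x u"] by (simp add: o_def)
qed

lemma norm_derivative_state_le:
  assumes "t \<in> {0..T}" "u \<in> U"
  shows "norm (D t (x, u) (k, 0)) \<le> M * norm k"
proof (rule lipschitz_derivative_le[OF derivative_state[OF assms]])
  show "norm (\<phi> t y u - \<phi> t x u) \<le> M * norm (y - x)" for y
    using lipschitz[OF assms assms(2), of y x] by simp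
qed

lemma remainder_state:
  assumes t: "t \<in> {0..T}" and u: "u \<in> U"
  shows "norm (\<phi> t y u - \<phi> t x u - D t (x, u) (y - x, 0)) \<le> M * (norm (y - x))\<^sup>2"
proof (rule first_order_remainder_le[where S = UNIV and F' = "\<lambda>z k. D t (z, u) (k, 0)"])
  show "norm (D t (z, u) (y - x, 0) - D t (x, u) (y - x, 0)) \<le> M * norm (z - x) * norm (y - x)" for z
    using derivative_lipschitz[OF t u u, of z "y - x" x] by simp
qed (use derivative_state[OF t u] M in auto)

text \<open>The increment is split at \<open>(x, v)\<close>: a state remainder at control
  \<open>v\<close>, the change of the state derivative when \<open>v\<close> is replaced by
  \<open>u\<close>, and a control remainder at state \<open>x\<close>. The middle, mixed term is
  controlled by \<open>derivative_lipschitz\<close> and then split by Young's inequality, which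
  accounts for the second \<open>M\<close> in the constant.\<close>

lemma remainder:
  assumes t: "t \<in> {0..T}" and u: "u \<in> U" and v: "v \<in> U"
  shows "norm (\<phi> t y v - \<phi> t x u - D t (x, u) (y - x, v - u))
    \<le> (2 * M + K) * ((norm (y - x))\<^sup>2 + (norm (v - u))\<^sup>2)"
proof -
  have "norm (\<phi> t y v - \<phi> t x u - D t (x, u) (y - x, v - u))
      = norm ((\<phi> t y v - \<phi> t x v - D t (x, v) (y - x, 0))
        + (D t (x, v) (y - x, 0) - D t (x, u) (y - x, 0))
        + (\<phi> t x v - \<phi> t x u - D t (x, u) (0, v - u)))"
    by (simp add: D_split[OF t u, of x "y - x" "v - u"] algebra_simps)
  also have "\<dots> \<le> M * (norm (y - x))\<^sup>2 + M * (norm (v - u) * norm (y - x)) + K * (norm (v - u))\<^sup>2"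
    using remainder_state[OF t v, of y x] derivative_lipschitz[OF t v u, of x "y - x" x]
      remainder_control[OF t u v, of x]
    by (intro norm_triangle_le add_mono) (simp_all add: mult.assoc)
  also have "norm (v - u) * norm (y - x) \<le> (norm (y - x))\<^sup>2 + (norm (v - u))\<^sup>2"
    using sum_squares_bound[of "norm (v - u)" "norm (y - x)"]
      mult_nonneg_nonneg[OF norm_ge_zero norm_ge_zero, of "v - u" "y - x"] by linarith
  finally show ?thesis
    using M K by (auto simp: algebra_simps intro: order_trans add_mono)
qed

lemma continuous_on_path:
  assumes "continuous_on {0..T} x" "continuous_on {0..T} u" "u ` {0..T} \<subseteq> U"
  shows "continuous_on {0..T} (\<lambda>t. \<phi> t (x t) (u t))"
proof -
  have "continuous_on {0..T} (\<lambda>t. case (t, x t, u t) of (t, x, u) \<Rightarrow> \<phi> t x u)"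
    by (rule continuous_on_compose2[OF continuous]) (use assms in \<open>auto intro!: continuous_intros\<close>)
  then show ?thesis by simp
qed

text \<open>
  \<open>D t z\<close> is not assumed continuous in \<open>t\<close>; by the remainder bound, it is a uniform limit of difference
  quotients of the jointly continuous \<open>\<phi>\<close>.
\<close>

lemma continuous_on_derivative_path:
  assumes x: "continuous_on {0..T} x" and k: "continuous_on {0..T} k"
    and u: "continuous_on {0..T} u" "u ` {0..T} \<subseteq> U"
    and v: "continuous_on {0..T} v" "v ` {0..T} \<subseteq> U"
  shows "continuous_on {0..T} (\<lambda>t. D t (x t, u t) (k t, v t - u t))"
proof -
  \<comment> \<open>Step sizes in \<open>(0, 1]\<close>, so that
    \<open>u t + e n *\<^sub>R (v t - u t)\<close> remains in the convex set
    \<open>U\<close>.\<close>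
  define e where "e n = 1 / real (Suc n)" for n
  define q where "q n t = (\<phi> t (x t + e n *\<^sub>R k t) (u t + e n *\<^sub>R (v t - u t)) - \<phi> t (x t) (u t)) /\<^sub>R e n" for n t
  have e: "0 < e n" "e n \<le> 1" for n
    by (auto simp: e_def)
  have mem: "u t + e n *\<^sub>R (v t - u t) \<in> U" if "t \<in> {0..T}" for n t
  proof -
    have "(1 - e n) *\<^sub>R u t + e n *\<^sub>R v t \<in> U"
      using that u(2) v(2) e[of n] by (intro convexD_alt[OF convex]) auto
    then show ?thesis by (simp add: algebra_simps)
  qed
  have cq: "continuous_on {0..T} (q n)" for n
    unfolding q_def using mem by (intro continuous_intros continuous_on_path x k u v) auto
  have "bdd_above ((\<lambda>t. (norm (k t))\<^sup>2 + (norm (v t - u t))\<^sup>2) ` {0..T})"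
    by (intro bounded_imp_bdd_above compact_imp_bounded compact_continuous_image continuous_intros k u v)
      auto
  then obtain B where B: "\<And>t. t \<in> {0..T} \<Longrightarrow> (norm (k t))\<^sup>2 + (norm (v t - u t))\<^sup>2 \<le> B"
    unfolding bdd_above_def by blast
  \<comment> \<open>For the increment scaled by \<open>e n\<close> the remainder is of order
    \<open>(e n)\<^sup>2\<close>; dividing by \<open>e n\<close> leaves order \<open>e n\<close>,
    uniformly in \<open>t\<close> thanks to \<open>B\<close>.\<close>
  have dist: "norm (q n t - D t (x t, u t) (k t, v t - u t)) \<le> e n * ((2 * M + K) * B)" if t: "t \<in> {0..T}" for n t
  proof -
    have ut: "u t \<in> U"
      using u(2) t by blast
    have D: "D t (x t, u t) (e n *\<^sub>R k t, e n *\<^sub>R (v t - u t)) = e n *\<^sub>R D t (x t, u t) (k t, v t - u t)"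
      using linear_scale[OF linear_D[OF t ut], of "x t" "e n" "(k t, v t - u t)"] by (simp only: scaleR_Pair)
    have q: "e n *\<^sub>R q n t = \<phi> t (x t + e n *\<^sub>R k t) (u t + e n *\<^sub>R (v t - u t)) - \<phi> t (x t) (u t)"
      using e[of n] by (simp add: q_def)
    have "e n * norm (q n t - D t (x t, u t) (k t, v t - u t))
        = norm (e n *\<^sub>R q n t - D t (x t, u t) (e n *\<^sub>R k t, e n *\<^sub>R (v t - u t)))"
      using e[of n] unfolding D scaleR_diff_right[of "e n" "q n t", symmetric] by simp
    also have "\<dots> \<le> (2 * M + K) * ((norm (e n *\<^sub>R k t))\<^sup>2 + (norm (e n *\<^sub>R (v t - u t)))\<^sup>2)"
      using remainder[OF t ut mem[OF t, of n], of "x t + e n *\<^sub>R k t" "x t"]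
      unfolding q add_diff_cancel_left' .
    also have "\<dots> = e n * (e n * ((2 * M + K) * ((norm (k t))\<^sup>2 + (norm (v t - u t))\<^sup>2)))"
      using e[of n] by (simp add: power_mult_distrib power2_eq_square[of "e n"] distrib_left mult_ac)
    also have "\<dots> \<le> e n * (e n * ((2 * M + K) * B))"
      using e[of n] M K B[OF t] by (intro mult_left_mono) auto
    finally have "e n * norm (q n t - D t (x t, u t) (k t, v t - u t)) \<le> e n * (e n * ((2 * M + K) * B))" .
    then show ?thesis
      by (rule mult_left_le_imp_le[OF _ e(1)])
  qed
  have lim: "(\<lambda>n. e n * ((2 * M + K) * B)) \<longlonglongrightarrow> 0"
    unfolding e_def by (rule tendsto_mult_left_zero[OF LIMSEQ_Suc[OF lim_1_over_n]])
  have "uniform_limit {0..T} q (\<lambda>t. D t (x t, u t) (k t, v t - u t)) sequentially"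
  proof (rule uniform_limitI)
    fix r :: real assume "r > 0"
    with lim have "\<forall>\<^sub>F n in sequentially. e n * ((2 * M + K) * B) < r"
      by (rule order_tendstoD)
    then show "\<forall>\<^sub>F n in sequentially. \<forall>t\<in>{0..T}. dist (q n t) (D t (x t, u t) (k t, v t - u t)) < r"
      by eventually_elim (auto simp only: dist_norm intro: le_less_trans[OF dist])
  qed
  then show ?thesis
    by (rule uniform_limit_theorem[rotated]) (use cq in auto)
qed

end

text \<open>The mean value inequality is used twice along the segment, first for the derivative in
  direction \<open>y - x\<close>, then for \<open>F\<close>. Only values of \<open>F''\<close> on
  the pair \<open>(y - x, y - x)\<close> enter, so for a segment with fixed state a bound on the
  second control derivative is enough.\<close>

lemma second_derivative_segment_remainder:
  fixes F :: "'a::real_normed_vector \<Rightarrow> 'b::real_normed_vector"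
  assumes S: "convex S" "x \<in> S" "y \<in> S"
    and C2: "C2_on_with S F F' F''"
    and B: "\<And>z. z \<in> S \<Longrightarrow> norm (F'' z (y - x) (y - x)) \<le> B"
  shows "norm (F y - F x - F' x (y - x)) \<le> B"
proof -
  let ?c = "\<lambda>s. x + s *\<^sub>R (y - x)"
  have F: "(F has_derivative F' z) (at z within S)"
    and F': "((\<lambda>z. F' z (y - x)) has_derivative (\<lambda>k. F'' z k (y - x))) (at z within S)" if "z \<in> S" for z
    using C2 that unfolding C2_on_with_def by (auto intro!: derivative_eq_intros)
  have mem: "?c s \<in> S" if "s \<in> {0..1}" for s
    using S that by (auto simp: algebra_simps convex_alt)
  have "B \<ge> 0" using B[OF S(2)] norm_ge_zero order_trans by blast
  have "norm (F' (?c s) (y - x) - F' (?c 0) (y - x)) \<le> B" if s: "s \<in> {0..1}" for s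
  proof -
    have "norm (F' (?c s) (y - x) - F' (?c 0) (y - x)) \<le> B * norm (s - 0)"
    proof (rule differentiable_bound[where S = "{0..1}"])
      show "((\<lambda>s. F' (?c s) (y - x)) has_derivative (\<lambda>r. r *\<^sub>R F'' (?c s) (y - x) (y - x))) (at s within {0..1})"
        if "s \<in> {0..1}" for s
        using has_derivative_along_segment[OF S F' that] by (simp add: has_vector_derivative_def)
      show "onorm (\<lambda>r. r *\<^sub>R F'' (?c s) (y - x) (y - x)) \<le> B" if "s \<in> {0..1}" for s :: real
        using mult_left_mono[OF B[OF mem[OF that]] abs_ge_zero]
        by (intro onorm_le) (simp add: mult.commute)
    qed (use s in auto)
    also have "\<dots> \<le> B" using s \<open>B \<ge> 0\<close> mult_left_mono[of s 1 B] by auto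
    finally show ?thesis .
  qed
  then have "norm (F (?c 1) - F (?c 0) - (1 - 0) *\<^sub>R F' (?c 0) (y - x)) \<le> norm (1 - 0 :: real) * B"
    by (intro vector_differentiable_bound_linearization[OF has_derivative_along_segment[OF S F]])
      (auto simp: closed_segment_eq_real_ivl)
  then show ?thesis by simp
qed

lemma smooth_coefficient_exists:
  fixes \<phi> :: "real \<Rightarrow> real ^ 'd \<Rightarrow> real ^ 'm \<Rightarrow> 'b::real_normed_vector"
  assumes U: "convex U" and M: "M > 0" and K: "K > 0"
    and 1: "first_order_regular T U M \<phi>"
    and 2: "second_order_regular T U M K \<phi>"
  obtains D where "smooth_coefficient T M K U \<phi> D"
proof -
  obtain D D2 where
    C2: "\<And>t. t \<in> {0..T} \<Longrightarrow> C2_on_with (UNIV \<times> U) (\<lambda>(x, u). \<phi> t x u) (D t) (D2 t)"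
    and lip: "\<And>t x x' u u'. \<lbrakk>t \<in> {0..T}; u \<in> U; u' \<in> U\<rbrakk> \<Longrightarrow>
       norm ((D t (x, u) o\<^sub>L inclusion_fst) - (D t (x', u') o\<^sub>L inclusion_fst))
         \<le> M * (norm (x - x') + norm (u - u'))"
    and D2: "\<And>t x u. \<lbrakk>t \<in> {0..T}; u \<in> U\<rbrakk> \<Longrightarrow>
       onorm (\<lambda>k. blinfun_apply (D2 t (x, u)) (0, k) o\<^sub>L inclusion_snd) \<le> K"
    using 2 unfolding second_order_regular_def by blast
  \<comment> \<open>The operator norm bound on the second control derivative, read as a bound on a
    bilinear map.\<close>
  have D2_le: "norm (D2 t (x, u) (0, k) (0, l)) \<le> K * norm k * norm l" if "t \<in> {0..T}" "u \<in> U" for t x u k l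
  proof -
    let ?A = "\<lambda>k. D2 t (x, u) (0, k) o\<^sub>L (inclusion_snd :: _ \<Rightarrow>\<^sub>L ((real ^ 'd) \<times> (real ^ 'm)))"
    have A: "bounded_linear ?A"
      by (intro bounded_linear_intros)
    have "norm (?A k l) \<le> norm (?A k) * norm l"
      by (rule norm_blinfun)
    also have "norm (?A k) \<le> onorm ?A * norm k"
      by (rule onorm[OF A])
    also have "onorm ?A \<le> K"
      by (rule D2[OF that])
    finally show ?thesis
      by (simp add: mult_right_mono)
  qed
  have "smooth_coefficient T M K U \<phi> (\<lambda>t z. blinfun_apply (D t z))"
  proof
    show "convex U" "0 < M" "0 \<le> K" using U M K by auto
    show "continuous_on ({0..T} \<times> UNIV \<times> U) (\<lambda>(t, x, u). \<phi> t x u)"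
      using 1 by (simp add: first_order_regular_def)
    fix t u assume t: "t \<in> {0..T}" and u: "u \<in> U"
    show "((\<lambda>(x, u). \<phi> t x u) has_derivative D t (x, u)) (at (x, u) within UNIV \<times> U)" for x
      using C2[OF t] u by (auto simp: C2_on_with_def)
    fix v assume v: "v \<in> U"
    show "norm (\<phi> t x u - \<phi> t x' v) \<le> M * (norm (x - x') + norm (u - v))" for x x'
      using 1 t u v by (auto simp: first_order_regular_def)
    show "norm (D t (x, u) (k, 0) - D t (x', v) (k, 0)) \<le> M * (norm (x - x') + norm (u - v)) * norm k" for x x' k
      using norm_blinfun[of "(D t (x, u) o\<^sub>L inclusion_fst) - (D t (x', v) o\<^sub>L inclusion_fst)" k]
        mult_right_mono[OF lip[OF t u v, of x x'], of "norm k"]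
      by (simp add: blinfun.diff_left)
    \<comment> \<open>The segment from \<open>(x, u)\<close> to \<open>(x, v)\<close> moves only the
      control, so the second derivative is evaluated only in directions
      \<open>(0, v - u)\<close>.\<close>
    have "norm ((\<lambda>(x, u). \<phi> t x u) (x, v) - (\<lambda>(x, u). \<phi> t x u) (x, u) - D t (x, u) ((x, v) - (x, u)))
        \<le> K * (norm (v - u))\<^sup>2" for x
    proof (rule second_derivative_segment_remainder[OF _ _ _ C2[OF t]])
      show "norm (D2 t z ((x, v) - (x, u)) ((x, v) - (x, u))) \<le> K * (norm (v - u))\<^sup>2" if "z \<in> UNIV \<times> U" for z
        using D2_le[OF t, of "snd z" "fst z" "v - u" "v - u"] that
        by (auto simp: power2_eq_square mult.assoc)
    qed (use U u v in \<open>auto intro: convex_Times\<close>)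
    then show "norm (\<phi> t x v - \<phi> t x u - D t (x, u) (0, v - u)) \<le> K * (norm (v - u))\<^sup>2" for x
      by simp
  qed
  then show ?thesis by (rule that)
qed

subsection \<open>First-order expansion of the cost\<close>

lemma gradient_inner:
  fixes F :: "'a::euclidean_space \<Rightarrow> real"
  assumes "(F has_derivative F') (at x)"
  shows "gradient F x \<bullet> k = F' k"
  using inner_gradient_within[of UNIV x "x + k"] assms by simp

text \<open>Reversing time turns the terminal value problem of the adjoint into an initial value
  problem, to which Picard iteration and Gronwall apply.\<close>

lemma has_vector_derivative_reverse:
  fixes p :: "real \<Rightarrow> 'a::real_normed_vector"
  assumes "(p has_vector_derivative p') (at (T - s) within {0..T})"
  shows "((\<lambda>s. p (T - s)) has_vector_derivative - p') (at s within {0..T})"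
proof -
  have "((\<lambda>s. T - s) has_vector_derivative - 1) (at s within {0..T})"
    by (auto intro!: derivative_eq_intros)
  moreover have "(p has_vector_derivative p') (at (T - s) within (\<lambda>s. T - s) ` {0..T})"
    by (rule has_vector_derivative_within_subset[OF assms]) auto
  ultimately have "(p \<circ> (\<lambda>s. T - s) has_vector_derivative - 1 *\<^sub>R p') (at s within {0..T})"
    by (rule vector_diff_chain_within)
  then show ?thesis
    by (simp add: o_def)
qed

text \<open>The term \<open>\<tau> * h\<close> is left out: neither the state nor the adjoint
  depends on it, and its contribution to the cost is treated separately and exactly.\<close>

locale control_problem =
  b: smooth_coefficient T M Kb U b Db + f: smooth_coefficient T M Kf U f Df
  for T M Kb Kf :: real
    and U :: "(real ^ 'm) set"
    and b :: "real \<Rightarrow> real ^ 'd \<Rightarrow> real ^ 'm \<Rightarrow> real ^ 'd"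
    and f :: "real \<Rightarrow> real ^ 'd \<Rightarrow> real ^ 'm \<Rightarrow> real"
    and Db Df +
  fixes x0 :: "real ^ 'd" and g :: "real ^ 'd \<Rightarrow> real"
  assumes T: "0 < T"
    and g: "C1_on UNIV g"
    and g_lipschitz: "\<bar>g x - g x'\<bar> \<le> M * norm (x - x')"
    and gradient_g_lipschitz: "norm (gradient g x - gradient g x') \<le> M * norm (x - x')"
begin

abbreviation "\<X> u \<equiv> state T x0 b u"
abbreviation "\<P> u \<equiv> adjoint_state T x0 b f g u"

lemma M: "0 < M"
  by (rule b.M)

lemma control_mem: "\<lbrakk>u \<in> controls T U; t \<in> {0..T}\<rbrakk> \<Longrightarrow> u t \<in> U"
  by (auto simp: controls_def)

section \<open>Gradients of the terminal cost and of the Hamiltonian\<close>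

lemma gradient_g: "(g has_derivative (\<lambda>k. gradient g x \<bullet> k)) (at x)"
proof -
  obtain g' where g': "(g has_derivative blinfun_apply (g' x)) (at x)"
    using g by (auto simp: C1_on_def)
  then show ?thesis
    by (simp add: gradient_inner[OF g'])
qed

lemma norm_gradient_g_le: "norm (gradient g x) \<le> M"
proof -
  have "norm (gradient g x \<bullet> gradient g x) \<le> M * norm (gradient g x)"
    by (rule lipschitz_derivative_le[OF gradient_g]) (use g_lipschitz in simp)
  then have "norm (gradient g x) * norm (gradient g x) \<le> M * norm (gradient g x)"
    by (simp add: power2_norm_eq_inner[symmetric] power2_eq_square)
  then show ?thesis
    using M by (cases "gradient g x = 0") auto
qed

lemma remainder_g: "\<bar>g y - g x - gradient g x \<bullet> (y - x)\<bar> \<le> M * (norm (y - x))\<^sup>2"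
proof -
  have "norm (gradient g z \<bullet> (y - x) - gradient g x \<bullet> (y - x)) \<le> M * norm (z - x) * norm (y - x)" for z
  proof -
    have "norm ((gradient g z - gradient g x) \<bullet> (y - x)) \<le> norm (gradient g z - gradient g x) * norm (y - x)"
      by (simp add: Cauchy_Schwarz_ineq2)
    also have "\<dots> \<le> M * norm (z - x) * norm (y - x)"
      by (intro mult_right_mono gradient_g_lipschitz) auto
    finally show ?thesis
      by (simp add: inner_diff_left)
  qed
  from first_order_remainder_le[OF convex_UNIV _ _ gradient_g this] M show ?thesis
    by simp
qed

lemma gradient_hamiltonian0_inner:
  assumes "t \<in> {0..T}" "u \<in> U"
  shows "gradient (\<lambda>y. hamiltonian0 b f t y p u) x \<bullet> k = p \<bullet> Db t (x, u) (k, 0) - Df t (x, u) (k, 0)"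
  unfolding hamiltonian0_def
  by (intro gradient_inner has_derivative_diff has_derivative_inner_right
      b.derivative_state f.derivative_state assms)

text \<open>The gradient is accessible through its inner products, so the difference is paired with
  itself and one factor of its norm is cancelled. The Hamiltonian is affine in \<open>p\<close>,
  hence the contributions of \<open>f\<close> cancel. This is the Lipschitz condition for solving
  the adjoint equation.\<close>

lemma norm_gradient_hamiltonian0_diff_le:
  assumes "t \<in> {0..T}" "u \<in> U"
  shows "norm (gradient (\<lambda>y. hamiltonian0 b f t y p u) x - gradient (\<lambda>y. hamiltonian0 b f t y p' u) x)
    \<le> M * norm (p - p')" (is "norm ?k \<le> _")
proof -
  have "norm ?k * norm ?k = ?k \<bullet> ?k"
    by (simp add: power2_norm_eq_inner[symmetric] power2_eq_square)
  also have "\<dots> = (p - p') \<bullet> Db t (x, u) (?k, 0)"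
    by (subst (1) inner_diff_left) (simp add: gradient_hamiltonian0_inner[OF assms] inner_diff_left)
  also have "\<dots> \<le> norm (p - p') * (M * norm ?k)"
    by (intro order_trans[OF norm_cauchy_schwarz] mult_left_mono b.norm_derivative_state_le assms) auto
  finally show ?thesis
    using M by (cases "?k = 0") (auto simp: mult_ac)
qed

lemma norm_gradient_hamiltonian0_le:
  assumes "t \<in> {0..T}" "u \<in> U"
  shows "norm (gradient (\<lambda>y. hamiltonian0 b f t y p u) x) \<le> M * (norm p + 1)" (is "norm ?k \<le> _")
proof -
  have "norm ?k * norm ?k = ?k \<bullet> ?k"
    by (simp add: power2_norm_eq_inner[symmetric] power2_eq_square)
  also have "\<dots> = p \<bullet> Db t (x, u) (?k, 0) - Df t (x, u) (?k, 0)"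
    by (rule gradient_hamiltonian0_inner[OF assms])
  also have "\<dots> \<le> norm p * (M * norm ?k) + M * norm ?k"
  proof -
    have "p \<bullet> Db t (x, u) (?k, 0) \<le> norm p * (M * norm ?k)"
      by (intro order_trans[OF norm_cauchy_schwarz] mult_left_mono b.norm_derivative_state_le assms) auto
    moreover have "- Df t (x, u) (?k, 0) \<le> M * norm ?k"
      using f.norm_derivative_state_le[OF assms, of x ?k] by simp
    ultimately show ?thesis by simp
  qed
  finally have "norm ?k * norm ?k \<le> (M * (norm p + 1)) * norm ?k"
    by (simp add: algebra_simps)
  then show ?thesis
    using M by (cases "?k = 0") auto
qed

lemma continuous_on_gradient_hamiltonian0:
  assumes u: "u \<in> controls T U" and x: "continuous_on {0..T} x" and p: "continuous_on {0..T} p"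
  shows "continuous_on {0..T} (\<lambda>t. gradient (\<lambda>y. hamiltonian0 b f t y (p t) (u t)) (x t))"
proof -
  have u': "continuous_on {0..T} u" "u ` {0..T} \<subseteq> U"
    using u by (auto simp: controls_def)
  \<comment> \<open>The gradient is rebuilt from its coordinates, which are derivatives of
    \<open>b\<close> and \<open>f\<close> in state directions. The zero control direction is written
    \<open>u t - u t\<close> to match \<open>continuous_on_derivative_path\<close> with
    \<open>v = u\<close>.\<close>
  have "continuous_on {0..T} (\<lambda>t. \<Sum>i\<in>Basis. (p t \<bullet> Db t (x t, u t) (i, u t - u t)
      - Df t (x t, u t) (i, u t - u t)) *\<^sub>R i)"
    by (intro continuous_intros b.continuous_on_derivative_path f.continuous_on_derivative_path x p u')
  then show ?thesis
  proof (rule continuous_on_eq)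
    show "(\<Sum>i\<in>Basis. (p t \<bullet> Db t (x t, u t) (i, u t - u t) - Df t (x t, u t) (i, u t - u t)) *\<^sub>R i)
        = gradient (\<lambda>y. hamiltonian0 b f t y (p t) (u t)) (x t)" if "t \<in> {0..T}" for t
      using gradient_hamiltonian0_inner[OF that control_mem[OF u that], of "p t" "x t"]
        euclidean_representation[of "gradient (\<lambda>y. hamiltonian0 b f t y (p t) (u t)) (x t)"]
      by simp
  qed
qed

section \<open>State and adjoint: existence and bounds\<close>

lemma is_state_state:
  assumes u: "u \<in> controls T U"
  shows "is_state T x0 b u (\<X> u)"
proof -
  have u': "continuous_on {0..T} u" "u ` {0..T} \<subseteq> U"
    using u by (auto simp: controls_def)
  \<comment> \<open>\<open>state\<close> is a choice, so its properties rest on the existence of a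
    solution, supplied here by Picard iteration.\<close>
  obtain x where "x 0 = x0"
    "\<And>t. t \<in> {0..T} \<Longrightarrow> (x has_vector_derivative b t (x t) (u t)) (at t within {0..T})"
  proof (rule ode_solution_exists[where F = "\<lambda>t x. b t x (u t)" and K = M and T = T])
    show "norm (b t x (u t) - b t y (u t)) \<le> M * norm (x - y)" if "t \<in> {0..T}" for t x y
      using b.lipschitz[OF that control_mem[OF u that] control_mem[OF u that], of x y] by simp
  qed (use T b.continuous_on_path u' in auto)
  then have "is_state T x0 b u x"
    by (simp add: is_state_def)
  then show ?thesis
    unfolding state_def by (rule someI[where P = "is_state T x0 b u"])
qed

lemma state_derivative:
  "\<lbrakk>u \<in> controls T U; t \<in> {0..T}\<rbrakk> \<Longrightarrow>
    (\<X> u has_vector_derivative b t (\<X> u t) (u t)) (at t within {0..T})"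
  using is_state_state by (simp add: is_state_def)

lemma continuous_on_state: "u \<in> controls T U \<Longrightarrow> continuous_on {0..T} (\<X> u)"
  by (rule continuous_on_vector_derivative) (rule state_derivative)

lemma is_adjoint_state_adjoint_state:
  assumes u: "u \<in> controls T U"
  shows "is_adjoint_state T b f g u (\<X> u) (\<P> u)"
proof -
  have u': "continuous_on {0..T} u" "u ` {0..T} \<subseteq> U"
    using u by (auto simp: controls_def)
  let ?G = "\<lambda>t p. gradient (\<lambda>y. hamiltonian0 b f t y p (u t)) (\<X> u t)"
  \<comment> \<open>\<open>q s\<close> stands for the adjoint at time \<open>T - s\<close>; the
    reversal removes the minus sign of the adjoint equation.\<close>
  obtain q where q0: "q 0 = - gradient g (\<X> u T)"
    and q: "\<And>s. s \<in> {0..T} \<Longrightarrow> (q has_vector_derivative ?G (T - s) (q s)) (at s within {0..T})"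
  proof (rule ode_solution_exists[where F = "\<lambda>s. ?G (T - s)" and K = M and T = T])
    show "norm (?G (T - s) p - ?G (T - s) p') \<le> M * norm (p - p')" if "s \<in> {0..T}" for s p p'
      using that by (intro norm_gradient_hamiltonian0_diff_le control_mem[OF u]) auto
    fix q :: "real \<Rightarrow> real ^ 'd"
    have rev: "continuous_on {0..T} (\<lambda>s. c (T - s))" if "continuous_on {0..T} c" for c :: "real \<Rightarrow> real ^ 'd"
      by (rule continuous_on_compose2[OF that]) (auto intro!: continuous_intros)
    assume "continuous_on {0..T} q"
    from rev[OF continuous_on_gradient_hamiltonian0[OF u continuous_on_state[OF u] rev[OF this]]]
    show "continuous_on {0..T} (\<lambda>s. ?G (T - s) (q s))"
      by simp
  qed (use T in auto)
  have "is_adjoint_state T b f g u (\<X> u) (\<lambda>t. q (T - t))"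
    unfolding is_adjoint_state_def
  proof (intro conjI ballI)
    fix t assume "t \<in> {0..T}"
    then show "((\<lambda>t. q (T - t)) has_vector_derivative - ?G t (q (T - t))) (at t within {0..T})"
      using has_vector_derivative_reverse[OF q[of "T - t"]] by simp
  qed (simp add: q0)
  then show ?thesis
    unfolding adjoint_state_def by (rule someI[where P = "is_adjoint_state T b f g u (\<X> u)"])
qed

lemma adjoint_derivative:
  "\<lbrakk>u \<in> controls T U; t \<in> {0..T}\<rbrakk> \<Longrightarrow>
    (\<P> u has_vector_derivative - gradient (\<lambda>y. hamiltonian0 b f t y (\<P> u t) (u t)) (\<X> u t))
      (at t within {0..T})"
  using is_adjoint_state_adjoint_state by (simp add: is_adjoint_state_def)

lemma adjoint_terminal: "u \<in> controls T U \<Longrightarrow> \<P> u T = - gradient g (\<X> u T)"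
  using is_adjoint_state_adjoint_state by (simp add: is_adjoint_state_def)

lemma continuous_on_adjoint: "u \<in> controls T U \<Longrightarrow> continuous_on {0..T} (\<P> u)"
  by (rule continuous_on_vector_derivative) (rule adjoint_derivative)

text \<open>The Gronwall bound for the adjoint in reversed time: the initial vector has norm at most
  \<open>M\<close>, and the growth bound \<open>M * (norm p + 1)\<close> amounts to the constant
  forcing 1. The value does not depend on the control.\<close>

definition "P = sqrt (exp (3 * M * T) * (M\<^sup>2 + M * T))"

lemma P_nonneg: "0 \<le> P"
  using M T by (simp add: P_def)

lemma norm_adjoint_le:
  assumes u: "u \<in> controls T U" and t: "t \<in> {0..T}"
  shows "norm (\<P> u t) \<le> P"
  unfolding P_def
proof (rule real_le_rsqrt)
  let ?G = "\<lambda>t. gradient (\<lambda>y. hamiltonian0 b f t y (\<P> u t) (u t)) (\<X> u t)"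
  have "(norm (\<P> u (T - (T - t))))\<^sup>2
      \<le> exp (3 * M * T) * ((norm (\<P> u (T - 0)))\<^sup>2 + M * integral {0..T} (\<lambda>s. 1\<^sup>2))"
  proof (rule gronwall_square[where z = "\<lambda>s. \<P> u (T - s)" and z' = "\<lambda>s. ?G (T - s)"])
    fix s assume s: "s \<in> {0..T}"
    show "((\<lambda>s. \<P> u (T - s)) has_vector_derivative ?G (T - s)) (at s within {0..T})"
      using has_vector_derivative_reverse[OF adjoint_derivative[OF u, of "T - s"]] s by simp
    show "norm (?G (T - s)) \<le> M * (norm (\<P> u (T - s)) + 1)"
      using s by (intro norm_gradient_hamiltonian0_le control_mem[OF u]) auto
  qed (use M t in auto)
  also have "\<dots> \<le> exp (3 * M * T) * (M\<^sup>2 + M * T)"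
    using norm_gradient_g_le[of "\<X> u T"] T by (simp add: adjoint_terminal[OF u] power_mono)
  finally show "(norm (\<P> u t))\<^sup>2 \<le> exp (3 * M * T) * (M\<^sup>2 + M * T)"
    by simp
qed

text \<open>Both states start at \<open>x0\<close>, and the Lipschitz bound on \<open>b\<close>
  makes \<open>norm (v s - u s)\<close> the forcing term in Gronwall's inequality.\<close>

lemma norm_state_diff_le:
  assumes u: "u \<in> controls T U" and v: "v \<in> controls T U" and t: "t \<in> {0..T}"
  shows "(norm (\<X> v t - \<X> u t))\<^sup>2
    \<le> exp (3 * M * T) * M * integral {0..T} (\<lambda>s. (norm (v s - u s))\<^sup>2)"
proof -
  have "(norm (\<X> v t - \<X> u t))\<^sup>2 \<le> exp (3 * M * T) * ((norm (\<X> v 0 - \<X> u 0))\<^sup>2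
      + M * integral {0..T} (\<lambda>s. (norm (v s - u s))\<^sup>2))"
  proof (rule gronwall_square[where z = "\<lambda>s. \<X> v s - \<X> u s"
        and z' = "\<lambda>s. b s (\<X> v s) (v s) - b s (\<X> u s) (u s)"])
    show "continuous_on {0..T} (\<lambda>s. norm (v s - u s))"
      using u v by (auto simp: controls_def intro!: continuous_intros)
  qed (use M t in \<open>auto intro!: has_vector_derivative_diff state_derivative b.lipschitz
      control_mem[OF u] control_mem[OF v] u v\<close>)
  moreover have "\<X> v 0 = \<X> u 0"
    using is_state_state[OF u] is_state_state[OF v] by (simp add: is_state_def)
  ultimately show ?thesis
    by (simp add: mult.assoc)
qed

text \<open>The control gradient of \<open>hamiltonian0\<close> along the state and adjoint of
  \<open>u\<close>, paired with \<open>v - u\<close>. Using the derivatives \<open>Db\<close> and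
  \<open>Df\<close> avoids the choice involved in \<open>gradient_within\<close>.\<close>

definition hamiltonian_variation where
  "hamiltonian_variation u v t = \<P> u t \<bullet> Db t (\<X> u t, u t) (0, v t - u t) - Df t (\<X> u t, u t) (0, v t - u t)"

text \<open>The first factor bounds the remainder of the Hamiltonian relative to the squared
  increments; \<open>exp (3 * M * T) * M * T + 1\<close> comes from integrating the squared state
  and control increments, and the last summand from the remainder of \<open>g\<close>.\<close>

definition "C = (P * (2 * M + Kb) + (2 * M + Kf)) * (exp (3 * M * T) * M * T + 1) + M * (exp (3 * M * T) * M)"

lemma C_pos: "0 < C"
  unfolding C_def using M T P_nonneg b.K f.K
  by (intro add_nonneg_pos mult_nonneg_nonneg add_nonneg_nonneg mult_pos_pos) auto

lemma continuous_on_hamiltonian_variation: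
  assumes u: "u \<in> controls T U" and v: "v \<in> controls T U"
  shows "continuous_on {0..T} (hamiltonian_variation u v)"
  unfolding hamiltonian_variation_def
  using u v
  by (intro continuous_intros b.continuous_on_derivative_path f.continuous_on_derivative_path
      continuous_on_state continuous_on_adjoint) (auto simp: controls_def)

definition "cost0 u = integral {0..T} (\<lambda>t. f t (\<X> u t) (u t)) + g (\<X> u T)"

text \<open>
  Integrating \<open>\<P> u \<bullet> (\<X> v - \<X> u)\<close> by parts turns the first-order part of the cost difference
  into the variation of the Hamiltonian in the control alone; what is left is quadratic in
  \<open>(\<X> v - \<X> u, v - u)\<close>.
\<close>

lemma cost0_expansion:
  assumes u: "u \<in> controls T U" and v: "v \<in> controls T U"
  shows "\<bar>cost0 v - cost0 u + integral {0..T} (hamiltonian_variation u v)\<bar>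
    \<le> C * integral {0..T} (\<lambda>t. (norm (v t - u t))\<^sup>2)"
proof -
  let ?x = "\<X> u" and ?y = "\<X> v" and ?p = "\<P> u"
  define W where "W = integral {0..T} (\<lambda>t. (norm (v t - u t))\<^sup>2)"
  define E where "E = exp (3 * M * T) * M"
  define rb where "rb t = b t (?y t) (v t) - b t (?x t) (u t) - Db t (?x t, u t) (?y t - ?x t, v t - u t)" for t
  define rf where "rf t = f t (?y t) (v t) - f t (?x t) (u t) - Df t (?x t, u t) (?y t - ?x t, v t - u t)" for t
  \<comment> \<open>The first-order remainder of \<open>hamiltonian0\<close> jointly in state and
    control, with the adjoint held fixed.\<close>
  define R where "R t = ?p t \<bullet> rb t - rf t" for t
  \<comment> \<open>The time derivative of \<open>?p t \<bullet> (?y t - ?x t)\<close>. Its integral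
    is a boundary term: zero at time 0, and given by the gradient of \<open>g\<close> at time
    \<open>T\<close>.\<close>
  define \<psi> where "\<psi> t = ?p t \<bullet> (b t (?y t) (v t) - b t (?x t) (u t))
      - gradient (\<lambda>y. hamiltonian0 b f t y (?p t) (u t)) (?x t) \<bullet> (?y t - ?x t)" for t
  have cu: "continuous_on {0..T} u" "u ` {0..T} \<subseteq> U" and cv: "continuous_on {0..T} v" "v ` {0..T} \<subseteq> U"
    using u v by (auto simp: controls_def)
  note cx = continuous_on_state[OF u] and cy = continuous_on_state[OF v] and cp = continuous_on_adjoint[OF u]
  have W: "((\<lambda>t. (norm (v t - u t))\<^sup>2) has_integral W) {0..T}"
    unfolding W_def by (intro integrable_integral integrable_continuous_real continuous_intros cu cv)
  have "((\<lambda>t. ?p t \<bullet> (?y t - ?x t)) has_vector_derivative \<psi> t) (at t within {0..T})" if t: "t \<in> {0..T}" for t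
  proof -
    have "((\<lambda>t. ?y t - ?x t) has_vector_derivative b t (?y t) (v t) - b t (?x t) (u t)) (at t within {0..T})"
      by (intro has_vector_derivative_diff state_derivative u v t)
    from has_derivative_inner[OF adjoint_derivative[OF u t, unfolded has_vector_derivative_def]
        this[unfolded has_vector_derivative_def]]
    show ?thesis
      unfolding has_vector_derivative_def \<psi>_def
      by (rule has_derivative_eq_rhs) (auto simp: algebra_simps inner_diff_right)
  qed
  then have "(\<psi> has_integral (?p T \<bullet> (?y T - ?x T) - ?p 0 \<bullet> (?y 0 - ?x 0))) {0..T}"
    using T by (intro fundamental_theorem_of_calculus) auto
  moreover have "?y 0 = ?x 0"
    using is_state_state[OF u] is_state_state[OF v] by (simp add: is_state_def)
  ultimately have \<psi>: "(\<psi> has_integral - (gradient g (?x T) \<bullet> (?y T - ?x T))) {0..T}"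
    by (simp add: adjoint_terminal[OF u])
  have contR: "continuous_on {0..T} R"
    unfolding R_def rb_def rf_def
    by (intro continuous_intros b.continuous_on_path f.continuous_on_path b.continuous_on_derivative_path
        f.continuous_on_derivative_path cx cy cp cu cv)
  have R_le: "norm (R t) \<le> (P * (2 * M + Kb) + (2 * M + Kf)) * (E * W + (norm (v t - u t))\<^sup>2)"
    if t: "t \<in> {0..T}" for t
  proof -
    let ?q = "(norm (?y t - ?x t))\<^sup>2 + (norm (v t - u t))\<^sup>2"
    note ut = control_mem[OF u t] and vt = control_mem[OF v t]
    have "norm (R t) \<le> norm (?p t) * norm (rb t) + norm (rf t)"
      unfolding R_def using norm_triangle_ineq4[of "?p t \<bullet> rb t" "rf t"] Cauchy_Schwarz_ineq2[of "?p t" "rb t"]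
      by simp
    also have "\<dots> \<le> P * ((2 * M + Kb) * ?q) + (2 * M + Kf) * ?q"
      unfolding rb_def rf_def
      by (intro add_mono mult_mono norm_adjoint_le b.remainder f.remainder u t ut vt P_nonneg norm_ge_zero)
    also have "\<dots> = (P * (2 * M + Kb) + (2 * M + Kf)) * ?q"
      by (simp add: algebra_simps)
    also have "\<dots> \<le> (P * (2 * M + Kb) + (2 * M + Kf)) * (E * W + (norm (v t - u t))\<^sup>2)"
      using norm_state_diff_le[OF u v t] P_nonneg M b.K f.K
      by (intro mult_left_mono add_right_mono add_nonneg_nonneg mult_nonneg_nonneg) (auto simp: E_def W_def)
    finally show ?thesis .
  qed
  have bound: "((\<lambda>t. (P * (2 * M + Kb) + (2 * M + Kf)) * (E * W + (norm (v t - u t))\<^sup>2))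
      has_integral (P * (2 * M + Kb) + (2 * M + Kf)) * (T * (E * W) + W)) {0..T}"
    using has_integral_const_real[of "E * W" 0 T] T
    by (intro has_integral_mult_right has_integral_add W) auto
  have intR: "(R has_integral integral {0..T} R) {0..T}"
    by (intro integrable_integral integrable_continuous_real contR)
  have R: "\<bar>integral {0..T} R\<bar> \<le> (P * (2 * M + Kb) + (2 * M + Kf)) * (T * (E * W) + W)"
    using integral_norm_bound_integral[OF has_integral_integrable[OF intR] has_integral_integrable[OF bound] R_le]
    unfolding integral_unique[OF bound] by simp
  \<comment> \<open>In \<open>\<psi> t - R t\<close> the increments of \<open>b\<close> cancel, and
    so do all derivatives in the state direction; what survives is the increment of \<open>f\<close>
    and the control variation.\<close>
  have eq: "f t (?y t) (v t) - f t (?x t) (u t) + hamiltonian_variation u v t = \<psi> t - R t"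
    if t: "t \<in> {0..T}" for t
    unfolding \<psi>_def R_def rb_def rf_def hamiltonian_variation_def
      gradient_hamiltonian0_inner[OF t control_mem[OF u t]]
      b.D_split[OF t control_mem[OF u t], of _ "?y t - ?x t" "v t - u t"]
      f.D_split[OF t control_mem[OF u t], of _ "?y t - ?x t" "v t - u t"]
    by (simp add: inner_diff_right inner_add_right)
  have "((\<lambda>t. \<psi> t - R t) has_integral
      integral {0..T} (\<lambda>t. f t (?y t) (v t)) - integral {0..T} (\<lambda>t. f t (?x t) (u t))
        + integral {0..T} (hamiltonian_variation u v)) {0..T}"
    by (rule has_integral_eq[OF eq], assumption)
      (intro has_integral_add has_integral_diff integrable_integral integrable_continuous_real
        f.continuous_on_path cx cy cu cv continuous_on_hamiltonian_variation u v)
  from has_integral_unique[OF this has_integral_diff[OF \<psi> intR]]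
  have "cost0 v - cost0 u + integral {0..T} (hamiltonian_variation u v)
      = (g (?y T) - g (?x T) - gradient g (?x T) \<bullet> (?y T - ?x T)) - integral {0..T} R"
    by (simp add: cost0_def)
  also have "\<bar>\<dots>\<bar> \<le> M * (norm (?y T - ?x T))\<^sup>2 + (P * (2 * M + Kb) + (2 * M + Kf)) * (T * (E * W) + W)"
    using remainder_g[of "?y T" "?x T"] R by linarith
  also have "M * (norm (?y T - ?x T))\<^sup>2 \<le> M * (E * W)"
    using norm_state_diff_le[OF u v, of T] M T by (intro mult_left_mono) (auto simp: E_def W_def)
  finally show ?thesis
    unfolding C_def E_def[symmetric] W_def[symmetric] by (simp add: algebra_simps)
qed

end

section \<open>Directional derivatives\<close>

lemma control_convex_combination:
  assumes "convex U" "u \<in> controls T U" "v \<in> controls T U" "\<epsilon> \<in> {0..1}"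
  shows "(\<lambda>t. u t + \<epsilon> *\<^sub>R (v t - u t)) \<in> controls T U"
proof -
  have "(1 - \<epsilon>) *\<^sub>R u t + \<epsilon> *\<^sub>R v t \<in> U" if "t \<in> {0..T}" for t
    using assms that by (intro convexD_alt) (auto simp: controls_def)
  then show ?thesis
    using assms by (auto simp: controls_def algebra_simps intro!: continuous_intros)
qed

text \<open>Dominated convergence along sequences in \<open>(0, 1)\<close>. By the tangent
  inequality and convexity, each difference quotient lies between
  \<open>h' (u t) (v t - u t)\<close> and \<open>h (v t) - h (u t)\<close>, both continuous in
  \<open>t\<close>.\<close>

lemma convex_integral_directional_derivative:
  assumes U: "convex U" and h: "convex_on U h"
    and h': "\<And>z. z \<in> U \<Longrightarrow> (h has_derivative blinfun_apply (h' z)) (at z within U)"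
    and contU: "continuous_on U h'"
    and tangent: "\<And>z w. \<lbrakk>z \<in> U; w \<in> U\<rbrakk> \<Longrightarrow> blinfun_apply (h' z) (w - z) \<le> h w - h z"
    and u: "u \<in> controls T U" and v: "v \<in> controls T U"
  shows "((\<lambda>\<epsilon>. (integral {0..T} (\<lambda>t. h (u t + \<epsilon> *\<^sub>R (v t - u t))) - integral {0..T} (\<lambda>t. h (u t))) / \<epsilon>)
    \<longlongrightarrow> integral {0..T} (\<lambda>t. blinfun_apply (h' (u t)) (v t - u t))) (at_right 0)"
proof (rule tendsto_at_right_sequentially[of 0 1])
  fix S :: "nat \<Rightarrow> real" assume S: "\<And>n. 0 < S n" "\<And>n. S n < 1" and lim: "S \<longlonglongrightarrow> 0"
  define q where "q n t = (h (u t + S n *\<^sub>R (v t - u t)) - h (u t)) / S n" for n t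
  have cu: "continuous_on {0..T} u" "u ` {0..T} \<subseteq> U" and cv: "continuous_on {0..T} v" "v ` {0..T} \<subseteq> U"
    using u v by (auto simp: controls_def)
  have conth: "continuous_on U h"
    by (rule has_derivative_continuous_on) (rule h')
  have h_path: "continuous_on {0..T} (\<lambda>t. h (w t))" if "w \<in> controls T U" for w
    using that by (intro continuous_on_compose2[OF conth]) (auto simp: controls_def)
  have mem: "(\<lambda>t. u t + S n *\<^sub>R (v t - u t)) \<in> controls T U" for n
    using S[of n] by (intro control_convex_combination U u v) auto
  have int: "(\<lambda>t. h (w t)) integrable_on {0..T}" if "w \<in> controls T U" for w
    by (intro integrable_continuous_real h_path that)
  have q: "(q n has_integral (integral {0..T} (\<lambda>t. h (u t + S n *\<^sub>R (v t - u t)))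
      - integral {0..T} (\<lambda>t. h (u t))) / S n) {0..T}" for n
    unfolding q_def
    by (intro has_integral_divide has_integral_diff integrable_integral int u mem)
  have cont': "continuous_on {0..T} (\<lambda>t. h' (u t) (v t - u t))"
    by (intro continuous_intros continuous_on_compose2[OF contU] cu cv)
  have "(\<lambda>n. integral {0..T} (q n)) \<longlonglongrightarrow> integral {0..T} (\<lambda>t. h' (u t) (v t - u t))"
  proof (rule dominated_convergence(2))
    show "q n integrable_on {0..T}" for n
      using q by blast
    show "(\<lambda>t. \<bar>h' (u t) (v t - u t)\<bar> + \<bar>h (v t) - h (u t)\<bar>) integrable_on {0..T}"
      by (intro integrable_continuous_real continuous_intros cont' h_path u v)
    fix t assume t: "t \<in> {0..T}"
    then have ut: "u t \<in> U" and vt: "v t \<in> U"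
      using cu cv by auto
    show "norm (q n t) \<le> \<bar>h' (u t) (v t - u t)\<bar> + \<bar>h (v t) - h (u t)\<bar>" for n
    proof -
      have "u t + S n *\<^sub>R (v t - u t) \<in> U"
        using mem[of n] t by (auto simp: controls_def)
      from tangent[OF ut this] have "S n * h' (u t) (v t - u t) \<le> h (u t + S n *\<^sub>R (v t - u t)) - h (u t)"
        by (simp add: blinfun.scaleR_right)
      then have "h' (u t) (v t - u t) \<le> q n t"
        using S[of n] by (simp add: q_def pos_le_divide_eq mult.commute)
      moreover have "h ((1 - S n) *\<^sub>R u t + S n *\<^sub>R v t) \<le> (1 - S n) * h (u t) + S n * h (v t)"
        using S[of n] by (intro convex_onD[OF h] ut vt) auto
      then have "h (u t + S n *\<^sub>R (v t - u t)) - h (u t) \<le> (h (v t) - h (u t)) * S n"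
        by (simp add: algebra_simps)
      then have "q n t \<le> h (v t) - h (u t)"
        using S[of n] by (simp add: q_def pos_divide_le_eq)
      ultimately show ?thesis
        by auto
    qed
    \<comment> \<open>The pointwise limit comes from the one-sided derivative at 0, since
      \<open>S\<close> takes values in \<open>(0, 1)\<close>.\<close>
    have "((\<lambda>s. h (u t + s *\<^sub>R (v t - u t))) has_field_derivative h' (u t) (v t - u t)) (at 0 within {0..1})"
      using has_derivative_along_segment[OF U ut vt h', of 0]
      by (simp add: has_real_derivative_iff_has_vector_derivative)
    then have "((\<lambda>s. (h (u t + s *\<^sub>R (v t - u t)) - h (u t)) / s) \<longlongrightarrow> h' (u t) (v t - u t)) (at 0 within {0..1})"
      by (simp add: has_field_derivative_iff)
    moreover have "filterlim S (at 0 within {0..1}) sequentially"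
      unfolding filterlim_at using S lim by (auto simp: less_imp_le less_imp_neq[symmetric])
    ultimately show "(\<lambda>n. q n t) \<longlonglongrightarrow> h' (u t) (v t - u t)"
      unfolding q_def by (rule filterlim_compose)
  qed
  then show "(\<lambda>n. (integral {0..T} (\<lambda>t. h (u t + S n *\<^sub>R (v t - u t))) - integral {0..T} (\<lambda>t. h (u t))) / S n)
      \<longlonglongrightarrow> integral {0..T} (\<lambda>t. h' (u t) (v t - u t))"
    by (simp add: integral_unique[OF q])
qed simp

context control_problem
begin

lemma hamiltonian_variation_scale:
  assumes "u \<in> controls T U" "t \<in> {0..T}"
  shows "hamiltonian_variation u (\<lambda>t. u t + \<epsilon> *\<^sub>R (v t - u t)) t = \<epsilon> * hamiltonian_variation u v t"
proof -
  note ut = control_mem[OF assms]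
  show ?thesis
    using linear_scale[OF b.linear_D[OF assms(2) ut], of "\<X> u t" \<epsilon> "(0, v t - u t)"]
      linear_scale[OF f.linear_D[OF assms(2) ut], of "\<X> u t" \<epsilon> "(0, v t - u t)"]
    by (simp add: hamiltonian_variation_def right_diff_distrib)
qed

text \<open>Along \<open>u + \<epsilon> (v - u)\<close> the linear term of
  \<open>cost0_expansion\<close> scales like \<open>\<epsilon>\<close> and the error bound like
  \<open>\<epsilon>\<^sup>2\<close>, so the difference quotient has error at most
  \<open>\<epsilon> * (C * W)\<close>.\<close>

lemma cost0_directional_derivative:
  assumes u: "u \<in> controls T U" and v: "v \<in> controls T U"
  shows "((\<lambda>\<epsilon>. (cost0 (\<lambda>t. u t + \<epsilon> *\<^sub>R (v t - u t)) - cost0 u) / \<epsilon>)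
    \<longlongrightarrow> - integral {0..T} (hamiltonian_variation u v)) (at_right 0)"
proof -
  let ?w = "\<lambda>\<epsilon> t. u t + \<epsilon> *\<^sub>R (v t - u t)"
  define A where "A = integral {0..T} (hamiltonian_variation u v)"
  define W where "W = integral {0..T} (\<lambda>t. (norm (v t - u t))\<^sup>2)"
  have "norm ((cost0 (?w \<epsilon>) - cost0 u) / \<epsilon> + A) \<le> \<epsilon> * (C * W)" if \<epsilon>: "0 < \<epsilon>" "\<epsilon> < 1" for \<epsilon>
  proof -
    have "integral {0..T} (hamiltonian_variation u (?w \<epsilon>)) = integral {0..T} (\<lambda>t. \<epsilon> * hamiltonian_variation u v t)"
      by (intro integral_cong hamiltonian_variation_scale u)
    also have "\<dots> = \<epsilon> * A"
      by (simp add: A_def)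
    finally have "\<bar>cost0 (?w \<epsilon>) - cost0 u + \<epsilon> * A\<bar> \<le> C * integral {0..T} (\<lambda>t. (norm (?w \<epsilon> t - u t))\<^sup>2)"
      using cost0_expansion[OF u control_convex_combination[OF b.convex u v, of \<epsilon>]] \<epsilon> by simp
    also have "\<dots> = \<epsilon> * (\<epsilon> * (C * W))"
      by (simp add: W_def power_mult_distrib power2_eq_square[of \<epsilon>] mult_ac)
    finally have "\<bar>cost0 (?w \<epsilon>) - cost0 u + \<epsilon> * A\<bar> / \<epsilon> \<le> \<epsilon> * (C * W)"
      using \<epsilon> by (simp add: pos_divide_le_eq mult.commute)
    moreover have "(cost0 (?w \<epsilon>) - cost0 u) / \<epsilon> + A = (cost0 (?w \<epsilon>) - cost0 u + \<epsilon> * A) / \<epsilon>"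
      using \<epsilon> by (simp add: add_divide_distrib)
    ultimately show ?thesis
      using \<epsilon> by simp
  qed
  then have "\<forall>\<^sub>F \<epsilon> in at_right 0. norm ((cost0 (?w \<epsilon>) - cost0 u) / \<epsilon> - (- A)) \<le> \<epsilon> * (C * W)"
    unfolding eventually_at_right_field by (intro exI[of _ 1]) auto
  moreover have "((\<lambda>\<epsilon>. \<epsilon> * (C * W)) \<longlongrightarrow> 0) (at_right 0)"
    by (auto intro!: tendsto_eq_intros)
  ultimately show ?thesis
    unfolding A_def[symmetric] by (rule LIM_zero_cancel[OF Lim_null_comparison])
qed

end

section \<open>The estimate relative to the Bregman divergence\<close>

theorem lemma5:
  fixes T \<tau> M Mbuu Mfuu \<sigma> :: real
    and x0 :: "real ^ 'd"
    and U :: "(real ^ 'm) set"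
    and b :: "real \<Rightarrow> real ^ 'd \<Rightarrow> real ^ 'm \<Rightarrow> real ^ 'd"
    and f :: "real \<Rightarrow> real ^ 'd \<Rightarrow> real ^ 'm \<Rightarrow> real"
    and g :: "real ^ 'd \<Rightarrow> real"
    and h :: "real ^ 'm \<Rightarrow> real"
  assumes "T > 0" and "\<tau> \<ge> 0"
    and "U \<noteq> {}" and "closed U" and "convex U"
    and "M > 0"
    and "first_order_regular T U M b" and "first_order_regular T U M f"
    and "Mbuu > 0" and "Mfuu > 0"
    and "second_order_regular T U M Mbuu b" and "second_order_regular T U M Mfuu f"
    and "C1_on UNIV g"
    and "\<And>x x'. max \<bar>g x - g x'\<bar> (norm (gradient g x - gradient g x')) \<le> M * norm (x - x')"
    and "\<bar>g 0\<bar> \<le> M"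
    and "convex_on U h" and "C1_on U h"
    and "\<exists>u_opt\<in>controls T U. \<forall>u\<in>controls T U.
           cost T x0 \<tau> b f g h u_opt \<le> cost T x0 \<tau> b f g h u"
    and "\<sigma> > 0"
    and "\<And>u v. u \<in> U \<Longrightarrow> v \<in> U \<Longrightarrow> bregman U h v u \<ge> \<sigma> / 2 * (norm (v - u))\<^sup>2"
  shows "\<exists>L>0. \<forall>u\<in>controls T U. \<forall>v\<in>controls T U.
    cost T x0 \<tau> b f g h v - cost T x0 \<tau> b f g h u
      \<le> dir_deriv (cost T x0 \<tau> b f g h) u v + L * bregman_path T U h v u
    \<and>
    cost T x0 \<tau> b f g h v - cost T x0 \<tau> b f g h u
      \<le> - integral {0..T} (\<lambda>t.
            gradient_within U
              (hamiltonian \<tau> b f h t (state T x0 b u t) (adjoint_state T x0 b f g u t)) (u t)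
            \<bullet> (v t - u t))
        + L * integral {0..T} (\<lambda>t. bregman U h (v t) (u t))"
proof -
  note U = \<open>convex U\<close> and M = \<open>M > 0\<close> and \<sigma> = \<open>\<sigma> > 0\<close> and strong = assms(20)
  obtain Db where Db: "smooth_coefficient T M Mbuu U b Db"
    by (rule smooth_coefficient_exists[OF U M \<open>Mbuu > 0\<close> \<open>first_order_regular T U M b\<close>
          \<open>second_order_regular T U M Mbuu b\<close>])
  obtain Df where Df: "smooth_coefficient T M Mfuu U f Df"
    by (rule smooth_coefficient_exists[OF U M \<open>Mfuu > 0\<close> \<open>first_order_regular T U M f\<close>
          \<open>second_order_regular T U M Mfuu f\<close>])
  interpret control_problem T M Mbuu Mfuu U b f Db Df x0 g
  proof (intro control_problem.intro control_problem_axioms.intro Db Df)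
    show "0 < T" "C1_on UNIV g" by fact+
    show "\<bar>g x - g x'\<bar> \<le> M * norm (x - x')" "norm (gradient g x - gradient g x') \<le> M * norm (x - x')" for x x'
      using assms(14)[of x x'] by simp_all
  qed
  obtain h' where h': "\<And>z. z \<in> U \<Longrightarrow> (h has_derivative blinfun_apply (h' z)) (at z within U)"
    and conth': "continuous_on U h'"
    using \<open>C1_on U h\<close> unfolding C1_on_def by blast
  \<comment> \<open>The chosen gradient in \<open>bregman\<close> acts on \<open>w - z\<close> as
    every derivative within \<open>U\<close> does, so it may be replaced by
    \<open>h'\<close>.\<close>
  have bregman: "bregman U h w z = h w - h z - h' z (w - z)" if "z \<in> U" "w \<in> U" for z w
    unfolding bregman_def by (simp add: inner_gradient_within[OF U that h'[OF that(1)]])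
  \<comment> \<open>The tangent inequality is read off from the lower bound on the Bregman
    divergence, which makes it nonnegative.\<close>
  have tangent: "h' z (w - z) \<le> h w - h z" if "z \<in> U" "w \<in> U" for z w
    using strong[OF that] \<sigma> bregman[OF that] by (smt (verit) divide_pos_pos mult_nonneg_nonneg zero_le_power2)
  have conth: "continuous_on U h"
    by (rule has_derivative_continuous_on) (rule h')
  have int_h: "(\<lambda>t. h (w t)) integrable_on {0..T}" if "w \<in> controls T U" for w
    using that by (intro integrable_continuous_real continuous_on_compose2[OF conth]) (auto simp: controls_def)
  have cost: "cost T x0 \<tau> b f g h w = cost0 w + \<tau> * integral {0..T} (\<lambda>t. h (w t))"
    if w: "w \<in> controls T U" for w
  proof -
    have "(\<lambda>t. f t (\<X> w t) (w t)) integrable_on {0..T}"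
      using w by (intro integrable_continuous_real f.continuous_on_path continuous_on_state) (auto simp: controls_def)
    then show ?thesis
      unfolding cost_def cost0_def by (simp add: integral_add int_h[OF w] integrable_on_mult_right)
  qed
  define L where "L = \<tau> + 2 * C / \<sigma>"
  have "0 < L"
    unfolding L_def using C_pos \<sigma> \<open>\<tau> \<ge> 0\<close> by (intro add_nonneg_pos divide_pos_pos) auto
  moreover
  {
    fix u v assume u: "u \<in> controls T U" and v: "v \<in> controls T U"
    have cu: "continuous_on {0..T} u" "u ` {0..T} \<subseteq> U" and cv: "continuous_on {0..T} v" "v ` {0..T} \<subseteq> U"
      using u v by (auto simp: controls_def)
    let ?w = "\<lambda>\<epsilon> t. u t + \<epsilon> *\<^sub>R (v t - u t)"
    define A where "A = integral {0..T} (hamiltonian_variation u v)"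
    define H where "H = integral {0..T} (\<lambda>t. h' (u t) (v t - u t))"
    define W where "W = integral {0..T} (\<lambda>t. (norm (v t - u t))\<^sup>2)"
    define Dh where "Dh = integral {0..T} (\<lambda>t. bregman U h (v t) (u t))"
    have A: "(hamiltonian_variation u v has_integral A) {0..T}"
      unfolding A_def by (intro integrable_integral integrable_continuous_real continuous_on_hamiltonian_variation u v)
    have H: "((\<lambda>t. h' (u t) (v t - u t)) has_integral H) {0..T}"
      unfolding H_def
      by (intro integrable_integral integrable_continuous_real continuous_intros continuous_on_compose2[OF conth'] cu cv)
    \<comment> \<open>Integrating the definition of the divergence shows that the \<open>h\<close>
      term of the cost contributes exactly \<open>\<tau> * H + \<tau> * Dh\<close>, hence the
      summand \<open>\<tau>\<close> in \<open>L\<close>.\<close>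
    have "((\<lambda>t. bregman U h (v t) (u t)) has_integral
        integral {0..T} (\<lambda>t. h (v t)) - integral {0..T} (\<lambda>t. h (u t)) - H) {0..T}"
      by (rule has_integral_eq[rotated, OF has_integral_diff[OF has_integral_diff[OF
            integrable_integral[OF int_h[OF v]] integrable_integral[OF int_h[OF u]]] H]])
        (simp add: bregman control_mem u v)
    then have Dh: "((\<lambda>t. bregman U h (v t) (u t)) has_integral Dh) {0..T}"
      and Dh_eq: "integral {0..T} (\<lambda>t. h (v t)) - integral {0..T} (\<lambda>t. h (u t)) = H + Dh"
      unfolding Dh_def by (auto simp: integral_unique)
    have W: "((\<lambda>t. \<sigma> / 2 * (norm (v t - u t))\<^sup>2) has_integral \<sigma> / 2 * W) {0..T}"
      unfolding W_def
      by (intro has_integral_mult_right integrable_integral integrable_continuous_real continuous_intros cu cv)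
    \<comment> \<open>Here the squared L2 distance of the controls is traded for their Bregman
      divergence.\<close>
    have "\<sigma> / 2 * W \<le> Dh"
      by (rule has_integral_le[OF W Dh]) (intro strong control_mem u v)
    then have "C * W \<le> C * (2 / \<sigma> * Dh)"
      using C_pos \<sigma> by (intro mult_left_mono) (auto simp: field_simps)
    then have "cost0 v - cost0 u \<le> - A + 2 * C / \<sigma> * Dh"
      using cost0_expansion[OF u v] unfolding A_def[symmetric] W_def[symmetric] by (simp add: mult_ac)
    moreover have "\<tau> * integral {0..T} (\<lambda>t. h (v t)) - \<tau> * integral {0..T} (\<lambda>t. h (u t)) = \<tau> * H + \<tau> * Dh"
      using Dh_eq by (simp add: right_diff_distrib[symmetric] distrib_left[symmetric])
    ultimately have main: "cost T x0 \<tau> b f g h v - cost T x0 \<tau> b f g h u \<le> - A + \<tau> * H + L * Dh"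
      unfolding cost[OF u] cost[OF v] L_def distrib_right by linarith
    have "((\<lambda>\<epsilon>. (cost0 (?w \<epsilon>) - cost0 u) / \<epsilon>
          + \<tau> * ((integral {0..T} (\<lambda>t. h (?w \<epsilon> t)) - integral {0..T} (\<lambda>t. h (u t))) / \<epsilon>))
        \<longlongrightarrow> - A + \<tau> * H) (at_right 0)"
      unfolding A_def H_def
      by (intro tendsto_add tendsto_mult tendsto_const cost0_directional_derivative u v
          convex_integral_directional_derivative[OF U \<open>convex_on U h\<close> h' conth' tangent])
    \<comment> \<open>The perturbed control is admissible for \<open>\<epsilon>\<close> in
      \<open>(0, 1)\<close>, so the decomposition of the cost holds eventually at
      \<open>0+\<close>.\<close>
    moreover have "\<forall>\<^sub>F \<epsilon> in at_right 0. (cost0 (?w \<epsilon>) - cost0 u) / \<epsilon>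
          + \<tau> * ((integral {0..T} (\<lambda>t. h (?w \<epsilon> t)) - integral {0..T} (\<lambda>t. h (u t))) / \<epsilon>)
        = (cost T x0 \<tau> b f g h (?w \<epsilon>) - cost T x0 \<tau> b f g h u) / \<epsilon>"
      unfolding eventually_at_right_field
    proof (intro exI[of _ 1] conjI allI impI)
      fix \<epsilon> :: real assume "0 < \<epsilon>" "\<epsilon> < 1"
      then show "(cost0 (?w \<epsilon>) - cost0 u) / \<epsilon>
          + \<tau> * ((integral {0..T} (\<lambda>t. h (?w \<epsilon> t)) - integral {0..T} (\<lambda>t. h (u t))) / \<epsilon>)
        = (cost T x0 \<tau> b f g h (?w \<epsilon>) - cost T x0 \<tau> b f g h u) / \<epsilon>"
        unfolding cost[OF u] by (subst cost[OF control_convex_combination[OF U u v]]) (auto simp: field_simps)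
    qed simp
    ultimately have "((\<lambda>\<epsilon>. (cost T x0 \<tau> b f g h (?w \<epsilon>) - cost T x0 \<tau> b f g h u) / \<epsilon>)
        \<longlongrightarrow> - A + \<tau> * H) (at_right 0)"
      by (rule Lim_transform_eventually)
    \<comment> \<open>\<open>Lim\<close> carries information only once a limit exists; the
      convergence just proved determines its value.\<close>
    then have dir: "dir_deriv (cost T x0 \<tau> b f g h) u v = - A + \<tau> * H"
      unfolding dir_deriv_def by (intro tendsto_Lim) auto
    \<comment> \<open>The Hamiltonian integral is the negative of the directional derivative, so
      both inequalities of the goal reduce to \<open>main\<close>.\<close>
    have "((\<lambda>t. gradient_within U (hamiltonian \<tau> b f h t (\<X> u t) (\<P> u t)) (u t) \<bullet> (v t - u t))
        has_integral A - \<tau> * H) {0..T}"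
    proof (rule has_integral_eq[OF _ has_integral_diff[OF A has_integral_mult_right[OF H]]])
      fix t assume t: "t \<in> {0..T}"
      note ut = control_mem[OF u t] and vt = control_mem[OF v t]
      have "(hamiltonian \<tau> b f h t (\<X> u t) (\<P> u t) has_derivative
          (\<lambda>l. \<P> u t \<bullet> Db t (\<X> u t, u t) (0, l) - Df t (\<X> u t, u t) (0, l) - \<tau> * h' (u t) l)) (at (u t) within U)"
        unfolding hamiltonian_def[abs_def] hamiltonian0_def
        by (intro has_derivative_diff has_derivative_inner_right has_derivative_mult_right
            b.derivative_control f.derivative_control h' t ut)
      from inner_gradient_within[OF U ut vt this]
      show "hamiltonian_variation u v t - \<tau> * h' (u t) (v t - u t)
          = gradient_within U (hamiltonian \<tau> b f h t (\<X> u t) (\<P> u t)) (u t) \<bullet> (v t - u t)"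
        by (simp add: hamiltonian_variation_def)
    qed
    note grad = integral_unique[OF this]
    have "cost T x0 \<tau> b f g h v - cost T x0 \<tau> b f g h u
        \<le> dir_deriv (cost T x0 \<tau> b f g h) u v + L * bregman_path T U h v u
      \<and> cost T x0 \<tau> b f g h v - cost T x0 \<tau> b f g h u
        \<le> - integral {0..T} (\<lambda>t. gradient_within U (hamiltonian \<tau> b f h t (\<X> u t) (\<P> u t)) (u t) \<bullet> (v t - u t))
          + L * integral {0..T} (\<lambda>t. bregman U h (v t) (u t))"
      using main unfolding dir grad bregman_path_def Dh_def by simp
  }
  ultimately show ?thesis
    by blast
qed

end
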